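(* Let $n\ge1$, $\sigma>0$, $\boldsymbol\mu\in\mathcal S_n^\uparrow$, and observe $\mathbf y=\boldsymbol\mu+\boldsymbol\xi$ with $\boldsymbol\xi\sim\mathcal N(\mathbf 0,\sigma^2 I_{n\times n})$. Let $\hat k=k(\Pi_{\mathcal S_n^\uparrow}(\mathbf y))$. Then for every $\gamma\in(0,1)$, with probability at least $1-\gamma$, $$\hat k\le 2k(\boldsymbol\mu)\log\Big(\frac{en}{k(\boldsymbol\mu)}\Big)+7\log(1/\gamma),$$ and moreover $$\mathbb E_{\boldsymbol\mu}[\hat k]\le k(\boldsymbol\mu)\log\Big(\frac{en}{k(\boldsymbol\mu)}\Big).$$
   Context: $\mathcal S_n^\uparrow=\{\mathbf u\in\mathbb R^n: u_1\le\dots\le u_n\}$ ($\mathcal S_1^\uparrow=\mathbb R$). $\Pi_{\mathcal S_n^\uparrow}$ is the Euclidean projection onto $\mathcal S_n^\uparrow$ (the least squares estimator). For $\mathbf u\in\mathbb R^n$, $k(\mathbf u)=|\{u_1,\dots,u_n\}|$, the number of distinct values (for nondecreasing $\mathbf u$, the number of constant pieces). $\mathbb E_{\boldsymbol\mu}$ is expectation under $\mathbf y=\boldsymbol\mu+\boldsymbol\xi$. *)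

theory Defs
  imports "HOL-Probability.Probability"
begin

text \<open>Vectors in R^n are represented as functions nat => real, extensional on {..<n}
  (index i corresponds to coordinate i+1).\<close>

definition mono_cone :: "nat \<Rightarrow> (nat \<Rightarrow> real) set" where
  "mono_cone n = {u \<in> extensional {..<n}. \<forall>i j. i \<le> j \<longrightarrow> j < n \<longrightarrow> u i \<le> u j}"

definition sqdist_n :: "nat \<Rightarrow> (nat \<Rightarrow> real) \<Rightarrow> (nat \<Rightarrow> real) \<Rightarrow> real" where
  "sqdist_n n y u = (\<Sum>i<n. (y i - u i)^2)"

definition iso_proj :: "nat \<Rightarrow> (nat \<Rightarrow> real) \<Rightarrow> (nat \<Rightarrow> real)" where
  "iso_proj n y = (THE u. u \<in> mono_cone n \<and> (\<forall>v \<in> mono_cone n. sqdist_n n y u \<le> sqdist_n n y v))"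

definition num_pieces :: "nat \<Rightarrow> (nat \<Rightarrow> real) \<Rightarrow> nat" where
  "num_pieces n u = card (u ` {..<n})"

definition gauss_obs :: "nat \<Rightarrow> (nat \<Rightarrow> real) \<Rightarrow> real \<Rightarrow> (nat \<Rightarrow> real) measure" where
  "gauss_obs n \<mu> \<sigma> = PiM {..<n} (\<lambda>i. density lborel (normal_density (\<mu> i) \<sigma>))"

end

theory Submission
  imports Defs
begin

text \<open>
  By the Karush-Kuhn-Tucker conditions the partial sums of the projection form the greatest convex
  minorant of the walk of partial sums of \<open>y\<close>, so its number of pieces counts the vertices of that
  minorant. A vertex of the whole walk lying in a constancy block of \<open>\<mu>\<close> is also a vertex of the walk
  restricted to the block; hence the number of pieces is at most the sum, over the blocks, of
  independent vertex counts, each belonging to a walk with i.i.d. atomless increments.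

  For such a walk of length \<open>m\<close> let \<open>K m\<close> be the vertex count. The face lengths add up to \<open>m\<close>, so
  \<open>m f(K m)\<close> is the sum over all faces of their lengths times \<open>f(K m)\<close>. Cutting out a face of length
  \<open>l\<close> leaves a walk of length \<open>m - l\<close> with one vertex less. Conversely, a block of \<open>l\<close> increments lying
  above its chord (by the cycle lemma exactly one of its \<open>l\<close> rotations does so) can be inserted as a
  face at exactly one place of the shorter walk, namely where the walk tilted by the slope of the
  block is minimal. By exchangeability,
  \<open>m E f(K m) \<le> (\<Sum>l=1..m. E f(1 + K (m - l)))\<close>. Taking \<open>f k = k\<close> gives \<open>E K m \<le> 1 + 1/2 + \<dots> + 1/m\<close>,
  and \<open>f k = 2 ^ k\<close> gives \<open>E 2 ^ K m \<le> m + 1\<close>. Concavity of the logarithm over the blocks yields the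
  bound in expectation, Markov's inequality for \<open>2 ^ K\<close> the bound in probability.
\<close>

section \<open>Isotonic fits and convex minorants\<close>

text \<open>The optimality conditions of the projection: the partial sums of \<open>u\<close> stay below those of \<open>y\<close> and
  touch them wherever \<open>u\<close> jumps (at \<open>k = m\<close> the premise is vacuous, so the totals agree).\<close>
definition isotonic_fit :: "nat \<Rightarrow> (nat \<Rightarrow> real) \<Rightarrow> (nat \<Rightarrow> real) \<Rightarrow> bool" where
  "isotonic_fit m y u \<longleftrightarrow>
     (\<forall>i j. i \<le> j \<longrightarrow> j < m \<longrightarrow> u i \<le> u j) \<and>
     (\<forall>k\<le>m. sum u {..<k} \<le> sum y {..<k}) \<and>
     (\<forall>k\<le>m. (\<forall>i<k. \<forall>j\<in>{k..<m}. u i < u j) \<longrightarrow> sum u {..<k} = sum y {..<k})"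

lemma isotonic_fit_mono: "isotonic_fit m y u \<Longrightarrow> i \<le> j \<Longrightarrow> j < m \<Longrightarrow> u i \<le> u j"
  and isotonic_fit_le: "isotonic_fit m y u \<Longrightarrow> k \<le> m \<Longrightarrow> sum u {..<k} \<le> sum y {..<k}"
  and isotonic_fit_eq: "isotonic_fit m y u \<Longrightarrow> k \<le> m \<Longrightarrow> (\<And>i j. i < k \<Longrightarrow> k \<le> j \<Longrightarrow> j < m \<Longrightarrow> u i < u j) \<Longrightarrow>
    sum u {..<k} = sum y {..<k}"
  unfolding isotonic_fit_def by simp_all

lemma sum_lessThan_add:
  fixes g :: "nat \<Rightarrow> real"
  shows "sum g {..<a + k} = sum g {..<a} + (\<Sum>i<k. g (a + i))"
  by (induction k) auto

text \<open>By monotonicity a level set is an interval of indices. At each of its ends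
  \<open>u\<close> jumps strictly, or the end is \<open>0\<close> or \<open>m\<close>, so the
  touching condition applies at both.\<close>

lemma isotonic_fit_level:
  assumes "isotonic_fit m y u" "s \<in> u ` {..<m}"
  obtains a b where "a < b" "b \<le> m" "\<And>i. i < a \<Longrightarrow> u i < s" "\<And>i. a \<le> i \<Longrightarrow> i < b \<Longrightarrow> u i = s"
    "\<And>i. b \<le> i \<Longrightarrow> i < m \<Longrightarrow> s < u i"
    "sum u {..<a} = sum y {..<a}" "sum u {..<b} = sum y {..<b}"
proof -
  define L where "L = {i. i < m \<and> u i = s}"
  define a where "a = Min L"
  define b where "b = Suc (Max L)"
  have fin: "finite L" and ne: "L \<noteq> {}"
    using assms(2) by (auto simp: L_def)
  have aL: "a \<in> L" and bL: "Max L \<in> L"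
    using fin ne by (auto simp: a_def)
  have min: "a \<le> i" and max: "i < b" if "i \<in> L" for i
    using that fin by (auto simp: a_def b_def less_Suc_eq_le)
  note mono = isotonic_fit_mono[OF assms(1)]
  have ab: "a < b" using max[OF aL] .
  have bm: "b \<le> m" using bL by (auto simp: L_def b_def)
  have 1: "u i < s" if "i < a" for i
    using mono[of i a] min[of i] that aL by (force simp: L_def)
  have 2: "u i = s" if "a \<le> i" "i < b" for i
    using mono[of a i] mono[of i "Max L"] that aL bL by (force simp: L_def b_def)
  have 3: "s < u i" if "b \<le> i" "i < m" for i
    using mono[of "Max L" i] max[of i] that bL by (force simp: L_def b_def)
  have 4: "sum u {..<a} = sum y {..<a}"
  proof (rule isotonic_fit_eq[OF assms(1)])
    fix i j assume "i < a" "a \<le> j" "j < m"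
    then show "u i < u j" using 1[of i] 2[of j] 3[of j] by (cases "j < b") auto
  qed (use ab bm in auto)
  have 5: "sum u {..<b} = sum y {..<b}"
  proof (rule isotonic_fit_eq[OF assms(1) bm])
    fix i j assume "i < b" "b \<le> j" "j < m"
    then show "u i < u j" using 1[of i] 2[of i] 3[of j] by (cases "i < a") auto
  qed
  show thesis using that[OF ab bm 1 2 3 4 5] by blast
qed

text \<open>The first piece is the longest prefix of minimal mean; the rest is fitted recursively.\<close>
lemma isotonic_fit_exists: "\<exists>u. isotonic_fit m y u"
proof (induction m arbitrary: y rule: less_induct)
  case (less m)
  show ?case
  proof (cases "m = 0")
    case True
    then show ?thesis by (auto simp: isotonic_fit_def)
  next
    case False
    define A where "A k = sum y {..<k} / real k" for k
    define c where "c = Min (A ` {1..m})"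
    define B where "B = {k \<in> {1..m}. A k = c}"
    define b where "b = Max B"
    have "c \<in> A ` {1..m}" unfolding c_def using False by (intro Min_in) auto
    then have "B \<noteq> {}" "finite B" by (auto simp: B_def)
    then have bB: "b \<in> B" by (simp add: b_def)
    then have b: "0 < b" "b \<le> m" "A b = c" by (auto simp: B_def)
    have cle: "c * real k \<le> sum y {..<k}" if "k \<le> m" for k
    proof (cases "k = 0")
      case False
      with that have "c \<le> A k" unfolding c_def by (intro Min_le) auto
      then show ?thesis using False by (simp add: A_def field_simps)
    qed simp
    have sb: "sum y {..<b} = c * real b" using b by (auto simp: A_def field_simps)
    \<comment> \<open>Strict because \<open>b\<close> is the largest prefix length attaining the
      minimal mean.\<close>
    have cless: "c * real k < sum y {..<k}" if "b < k" "k \<le> m" for k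
    proof -
      have "k \<notin> B" using that Max_ge[OF \<open>finite B\<close>, of k] by (auto simp: b_def)
      then have "A k \<noteq> c" using that by (auto simp: B_def)
      then have "sum y {..<k} \<noteq> c * real k" using that by (auto simp: A_def field_simps)
      then show ?thesis using cle[OF that(2)] by simp
    qed
    obtain v where v: "isotonic_fit (m - b) (\<lambda>i. y (b + i)) v"
      using less[of "m - b"] b False by auto
    \<comment> \<open>The first piece of \<open>v\<close> has mean \<open>v 0\<close> over its
      \<open>k\<close> entries. Appended to the first \<open>b\<close> entries it gives a longer
      prefix, whose mean exceeds \<open>c\<close>; hence \<open>v 0\<close> exceeds \<open>c\<close>
      as well.\<close>
    have vgt: "c < v j" if "j < m - b" for j
    proof -
      have v0: "v 0 \<in> v ` {..<m - b}" using that by auto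
      obtain a k where ak: "a < k" "k \<le> m - b" "\<And>i. i < a \<Longrightarrow> v i < v 0"
        "\<And>i. a \<le> i \<Longrightarrow> i < k \<Longrightarrow> v i = v 0" "\<And>i. k \<le> i \<Longrightarrow> i < m - b \<Longrightarrow> v 0 < v i"
        "sum v {..<a} = (\<Sum>i<a. y (b + i))" "sum v {..<k} = (\<Sum>i<k. y (b + i))"
        using isotonic_fit_level[OF v v0] by blast
      have "a = 0" using ak(3)[of 0] by auto
      then have "v i = v 0" if "i < k" for i using ak(4)[OF _ that] by simp
      then have "sum v {..<k} = (\<Sum>i<k. v 0)" by (intro sum.cong refl) (metis lessThan_iff)
      then have "sum v {..<k} = real k * v 0" by simp
      then have "sum y {..<b + k} = c * real b + real k * v 0"
        using ak(7) sb by (simp add: sum_lessThan_add)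
      moreover have "c * real (b + k) < sum y {..<b + k}"
        using ak(1,2) b by (intro cless) auto
      ultimately have "real k * c < real k * v 0" by (simp add: algebra_simps)
      then have "c < v 0" by (simp add: mult_less_cancel_left)
      also have "v 0 \<le> v j" using isotonic_fit_mono[OF v, of 0 j] that by simp
      finally show ?thesis .
    qed
    define u where "u i = (if i < b then c else v (i - b))" for i
    have u1: "sum u {..<k} = c * real k" if "k \<le> b" for k
      using that by (simp add: u_def)
    have u2: "sum u {..<b + k} = c * real b + sum v {..<k}" for k
      by (simp add: sum_lessThan_add u1) (simp add: u_def)
    have y2: "sum y {..<b + k} = c * real b + (\<Sum>i<k. y (b + i))" for k
      by (simp add: sum_lessThan_add sb)
    have "isotonic_fit m y u"
      unfolding isotonic_fit_def
    proof (intro conjI allI impI)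
      fix i j assume "i \<le> j" "j < m"
      then show "u i \<le> u j"
        using vgt[of "j - b"] isotonic_fit_mono[OF v, of "i - b" "j - b"] diff_less_mono[of j m b]
        by (auto simp: u_def)
    next
      fix k assume "k \<le> m"
      show "sum u {..<k} \<le> sum y {..<k}"
      proof (cases "k \<le> b")
        case True
        then show ?thesis using cle \<open>k \<le> m\<close> by (simp add: u1)
      next
        case False
        then have k: "k = b + (k - b)" by simp
        show ?thesis
          using isotonic_fit_le[OF v, of "k - b"] \<open>k \<le> m\<close>
          by (subst (1 2) k, unfold u2 y2) simp
      qed
    next
      fix k assume "k \<le> m" and sep: "\<forall>i<k. \<forall>j\<in>{k..<m}. u i < u j"
      consider "k = 0" | "0 < k" "k < b" | "b \<le> k" by linarith
      then show "sum u {..<k} = sum y {..<k}"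
      proof cases
        \<comment> \<open>Strictly inside the first piece \<open>u\<close> is constant, so the
          separation premise fails.\<close>
        case 2
        then have "u (k - 1) < u k" using sep b by auto
        then show ?thesis using 2 by (simp add: u_def split: if_splits)
      next
        case 3
        then have k: "k = b + (k - b)" by simp
        have "sum v {..<k - b} = (\<Sum>i<k - b. y (b + i))"
        proof (rule isotonic_fit_eq[OF v])
          fix i j assume "i < k - b" "k - b \<le> j" "j < m - b"
          then have "i + b < k" "k \<le> j + b" "j + b < m" by auto
          then have "u (i + b) < u (j + b)" using sep by auto
          then show "v i < v j" by (simp add: u_def)
        qed (use \<open>k \<le> m\<close> in auto)
        then show ?thesis by (subst (1 2) k, unfold u2 y2) simp
      qed simp
    qed
    then show ?thesis by blast
  qed
qed

text \<open>The index \<open>i\<close> stands for the vertex of the minorant at time \<open>Suc i\<close>, i.e. \<open>i\<close> is the last index of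
  a piece; the final index \<open>m - 1\<close> is always a vertex, the starting point of the walk is not counted.\<close>
definition vertices :: "nat \<Rightarrow> (nat \<Rightarrow> real) \<Rightarrow> nat set" where
  "vertices m y = {i \<in> {..<m}. \<forall>a\<in>{..i}. \<forall>b\<in>{Suc i<..m}.
     (sum y {..<Suc i} - sum y {..<a}) * (real b - real (Suc i))
       < (sum y {..<b} - sum y {..<Suc i}) * (real (Suc i) - real a)}"

lemma sum_diff_le:
  fixes u :: "nat \<Rightarrow> real"
  assumes "a \<le> b" "\<And>i. a \<le> i \<Longrightarrow> i < b \<Longrightarrow> u i \<le> c"
  shows "sum u {..<b} - sum u {..<a} \<le> c * (real b - real a)"
  using assms by (induction b rule: dec_induct) (force simp: algebra_simps)+

lemma sum_diff_ge:
  fixes u :: "nat \<Rightarrow> real"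
  assumes "a \<le> b" "\<And>i. a \<le> i \<Longrightarrow> i < b \<Longrightarrow> c \<le> u i"
  shows "c * (real b - real a) \<le> sum u {..<b} - sum u {..<a}"
  using assms by (induction b rule: dec_induct) (force simp: algebra_simps)+

text \<open>\<open>vertices\<close> compares, cross-multiplied, the slopes of the chords of
  \<open>y\<close> ending and starting at time \<open>Suc i\<close>. At a jump the fit touches
  \<open>y\<close> there and is nowhere above it, so left slopes are at most \<open>u i\<close> and
  right slopes at least \<open>u (Suc i)\<close>. Without a jump, the chords to the two ends of the
  level set violate the strict inequality.\<close>

lemma isotonic_fit_vertices:
  assumes fit: "isotonic_fit m y u"
  shows "vertices m y = {i \<in> {..<m}. Suc i < m \<longrightarrow> u i < u (Suc i)}"
proof -
  note mono = isotonic_fit_mono[OF fit]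
  have "i \<in> vertices m y \<longleftrightarrow> (Suc i < m \<longrightarrow> u i < u (Suc i))" if i: "i < m" for i
  proof
    assume "Suc i < m \<longrightarrow> u i < u (Suc i)"
    moreover have "i \<in> vertices m y" if "Suc i < m" "u i < u (Suc i)"
    proof -
      have eq: "sum u {..<Suc i} = sum y {..<Suc i}"
      proof (rule isotonic_fit_eq[OF fit])
        fix p q assume "p < Suc i" "Suc i \<le> q" "q < m"
        then show "u p < u q" using mono[of p i] mono[of "Suc i" q] that by auto
      qed (use that in auto)
      have "(sum y {..<Suc i} - sum y {..<a}) * (real b - real (Suc i))
        < (sum y {..<b} - sum y {..<Suc i}) * (real (Suc i) - real a)"
        if ab: "a \<le> i" "Suc i < b" "b \<le> m" for a b
      proof -
        have "sum y {..<Suc i} - sum y {..<a} \<le> sum u {..<Suc i} - sum u {..<a}"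
          using isotonic_fit_le[OF fit, of a] eq ab by simp
        also have "\<dots> \<le> u i * (real (Suc i) - real a)"
          using ab mono i by (intro sum_diff_le) auto
        finally have 1: "sum y {..<Suc i} - sum y {..<a} \<le> u i * (real (Suc i) - real a)" .
        have "u (Suc i) * (real b - real (Suc i)) \<le> sum u {..<b} - sum u {..<Suc i}"
          using ab mono i by (intro sum_diff_ge) auto
        also have "\<dots> \<le> sum y {..<b} - sum y {..<Suc i}"
          using isotonic_fit_le[OF fit, of b] eq ab by simp
        finally have 2: "u (Suc i) * (real b - real (Suc i)) \<le> sum y {..<b} - sum y {..<Suc i}" .
        have p: "0 < real (Suc i) - real a" "0 < real b - real (Suc i)" using ab by auto
        have "(sum y {..<Suc i} - sum y {..<a}) * (real b - real (Suc i))
            \<le> u i * (real (Suc i) - real a) * (real b - real (Suc i))"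
          using 1 p by (intro mult_right_mono) auto
        also have "\<dots> < u (Suc i) * (real (Suc i) - real a) * (real b - real (Suc i))"
          using p \<open>u i < u (Suc i)\<close> by (intro mult_strict_right_mono) auto
        also have "\<dots> = u (Suc i) * (real b - real (Suc i)) * (real (Suc i) - real a)" by simp
        also have "\<dots> \<le> (sum y {..<b} - sum y {..<Suc i}) * (real (Suc i) - real a)"
          using 2 p by (intro mult_right_mono) auto
        finally show ?thesis .
      qed
      then show ?thesis using i by (auto simp: vertices_def)
    qed
    \<comment> \<open>At the last index there is no right endpoint \<open>b\<close>, so the
      condition is vacuous.\<close>
    moreover have "i \<in> vertices m y" if "\<not> Suc i < m"
      using that i by (auto simp: vertices_def)
    ultimately show "i \<in> vertices m y" by blast
  next
    assume v: "i \<in> vertices m y"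
    show "Suc i < m \<longrightarrow> u i < u (Suc i)"
    proof (intro impI, rule ccontr)
      assume im: "Suc i < m" and "\<not> u i < u (Suc i)"
      then have eq: "u (Suc i) = u i" using mono[of i "Suc i"] by auto
      obtain a b where ab: "a < b" "b \<le> m" "\<And>j. j < a \<Longrightarrow> u j < u i"
        "\<And>j. a \<le> j \<Longrightarrow> j < b \<Longrightarrow> u j = u i" "\<And>j. b \<le> j \<Longrightarrow> j < m \<Longrightarrow> u i < u j"
        "sum u {..<a} = sum y {..<a}" "sum u {..<b} = sum y {..<b}"
        using isotonic_fit_level[OF fit, of "u i"] i by blast
      have ai: "a \<le> i" using ab(3)[of i] by force
      have bi: "Suc i < b" using ab(5)[of "Suc i"] eq im by force
      have d: "sum u {..<k} - sum u {..<a} = u i * (real k - real a)" if "a \<le> k" "k \<le> b" for k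
        using sum_diff_le[of a k u "u i"] sum_diff_ge[of a k "u i" u] ab(4) that by fastforce
      have 1: "u i * (real (Suc i) - real a) \<le> sum y {..<Suc i} - sum y {..<a}"
        using d[of "Suc i"] ai bi ab(6) isotonic_fit_le[OF fit, of "Suc i"] im by simp
      have 2: "sum y {..<b} - sum y {..<Suc i} \<le> u i * (real b - real (Suc i))"
      proof -
        have "sum u {..<b} - sum u {..<Suc i} = u i * (real b - real (Suc i))"
          using d[of "Suc i"] d[of b] ai bi by (simp add: algebra_simps del: sum.lessThan_Suc)
        then show ?thesis using ab(7) isotonic_fit_le[OF fit, of "Suc i"] im by linarith
      qed
      have p: "0 < real (Suc i) - real a" "0 < real b - real (Suc i)" using ai bi by auto
      have "(sum y {..<b} - sum y {..<Suc i}) * (real (Suc i) - real a)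
        \<le> u i * (real b - real (Suc i)) * (real (Suc i) - real a)"
        using 2 p by (intro mult_right_mono) auto
      also have "\<dots> = u i * (real (Suc i) - real a) * (real b - real (Suc i))" by simp
      also have "\<dots> \<le> (sum y {..<Suc i} - sum y {..<a}) * (real b - real (Suc i))"
        using 1 p by (intro mult_right_mono) auto
      finally show False using v ai bi ab(2) by (force simp: vertices_def)
    qed
  qed
  then show ?thesis by (auto simp: vertices_def)
qed

text \<open>Each value of \<open>u\<close> is matched with the last index of its level set, the only
  vertex in that set.\<close>

lemma isotonic_fit_card_image:
  assumes fit: "isotonic_fit m y u"
  shows "card (u ` {..<m}) = card (vertices m y)"
proof -
  have "bij_betw u (vertices m y) (u ` {..<m})"
    unfolding bij_betw_def
  proof
    have *: "u i < u j" if "i \<in> vertices m y" "i < j" "j < m" for i j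
      using that isotonic_fit_mono[OF fit, of "Suc i" j]
      unfolding isotonic_fit_vertices[OF fit] by auto
    show "inj_on u (vertices m y)"
    proof (rule inj_onI)
      fix i j assume "i \<in> vertices m y" "j \<in> vertices m y" "u i = u j"
      then show "i = j" using *[of i j] *[of j i] by (cases i j rule: linorder_cases) (auto simp: vertices_def)
    qed
    have "s \<in> u ` vertices m y" if s: "s \<in> u ` {..<m}" for s
    proof -
      obtain a b where ab: "a < b" "b \<le> m" "\<And>j. j < a \<Longrightarrow> u j < s"
        "\<And>j. a \<le> j \<Longrightarrow> j < b \<Longrightarrow> u j = s" "\<And>j. b \<le> j \<Longrightarrow> j < m \<Longrightarrow> s < u j"
        "sum u {..<a} = sum y {..<a}" "sum u {..<b} = sum y {..<b}"
        using isotonic_fit_level[OF fit s] by blast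
      have "u (b - 1) = s" using ab by auto
      moreover have "b - 1 \<in> vertices m y"
        using ab(1,2,5) \<open>u (b - 1) = s\<close> unfolding isotonic_fit_vertices[OF fit] by auto
      ultimately show ?thesis by blast
    qed
    then show "u ` vertices m y = u ` {..<m}" by (auto simp: vertices_def)
  qed
  then show ?thesis by (simp add: bij_betw_same_card)
qed

section \<open>The projection onto the monotone cone and its optimality conditions\<close>

lemma summation_by_parts:
  fixes d v :: "nat \<Rightarrow> real"
  shows "(\<Sum>i<Suc n. d i * v i) = sum d {..<Suc n} * v n - (\<Sum>i<n. sum d {..<Suc i} * (v (Suc i) - v i))"
  by (induction n) (auto simp: algebra_simps)

text \<open>Abel summation against the residual \<open>y - u\<close> gives the variational
  characterisation: the inner product with a monotone \<open>v\<close> is nonpositive, that with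
  \<open>u\<close> itself vanishes. Expanding squares yields a Pythagorean inequality, whose extra
  term \<open>sqdist_n n u v\<close> gives both minimality and uniqueness.\<close>

lemma iso_proj_eq_isotonic_fit:
  assumes fit: "isotonic_fit n y u"
  shows "iso_proj n y = restrict u {..<n}"
proof -
  define D where "D v = (\<Sum>i<n. (y i - u i) * v i)" for v
  note mono = isotonic_fit_mono[OF fit]
  have D_le: "D v \<le> 0" if "\<And>i j. i \<le> j \<Longrightarrow> j < n \<Longrightarrow> v i \<le> v j" for v
  proof (cases n)
    case (Suc k)
    have "sum u {..<n} = sum y {..<n}" by (rule isotonic_fit_eq[OF fit]) auto
    moreover have "0 \<le> (\<Sum>j<Suc i. y j - u j) * (v (Suc i) - v i)" if "i < k" for i
      using isotonic_fit_le[OF fit, of "Suc i"] \<open>\<And>i j. i \<le> j \<Longrightarrow> j < n \<Longrightarrow> v i \<le> v j\<close>[of i "Suc i"] that Suc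
      by (intro mult_nonneg_nonneg) (simp_all add: sum_subtractf del: sum.lessThan_Suc)
    then have "0 \<le> (\<Sum>i<k. (\<Sum>j<Suc i. y j - u j) * (v (Suc i) - v i))"
      by (intro sum_nonneg) auto
    ultimately show ?thesis
      unfolding D_def Suc summation_by_parts by (simp add: sum_subtractf del: sum.lessThan_Suc)
  qed (simp add: D_def)
  have D_u: "D u = 0"
  proof (cases n)
    case (Suc k)
    have "sum u {..<n} = sum y {..<n}" by (rule isotonic_fit_eq[OF fit]) auto
    \<comment> \<open>Complementary slackness: either \<open>u\<close> has no increment here, or it
      jumps and the partial sums agree.\<close>
    moreover have "(\<Sum>j<Suc i. y j - u j) * (u (Suc i) - u i) = 0" if "i < k" for i
    proof (cases "u i < u (Suc i)")
      case True
      have "sum u {..<Suc i} = sum y {..<Suc i}"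
      proof (rule isotonic_fit_eq[OF fit])
        fix p q assume "p < Suc i" "Suc i \<le> q" "q < n"
        then show "u p < u q" using mono[of p i] mono[of "Suc i" q] True by auto
      qed (use that Suc in auto)
      then show ?thesis by (simp add: sum_subtractf del: sum.lessThan_Suc)
    next
      case False
      then show ?thesis using mono[of i "Suc i"] that Suc by simp
    qed
    then have "(\<Sum>i<k. (\<Sum>j<Suc i. y j - u j) * (u (Suc i) - u i)) = 0"
      by (intro sum.neutral) auto
    ultimately show ?thesis
      unfolding D_def Suc summation_by_parts by (simp add: sum_subtractf del: sum.lessThan_Suc)
  qed (simp add: D_def)
  have dist: "sqdist_n n y v = sqdist_n n y u + sqdist_n n u v + 2 * (D u - D v)" for v
    unfolding sqdist_n_def D_def sum_subtractf[symmetric] sum.distrib[symmetric] sum_distrib_left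
    by (intro sum.cong refl) (simp add: power2_eq_square algebra_simps)
  have pyth: "sqdist_n n y u + sqdist_n n u v \<le> sqdist_n n y v" if "v \<in> mono_cone n" for v
    using dist[of v] D_u D_le[of v] that by (auto simp: mono_cone_def)
  \<comment> \<open>\<open>mono_cone n\<close> contains only extensional functions, while
    \<open>u\<close> is arbitrary from index \<open>n\<close> on; the distance does not see the
    difference.\<close>
  let ?r = "restrict u {..<n}"
  have r: "sqdist_n n y ?r = sqdist_n n y u" by (simp add: sqdist_n_def)
  have rc: "?r \<in> mono_cone n" using mono by (auto simp: mono_cone_def)
  show ?thesis
    unfolding iso_proj_def
  proof (rule the_equality)
    have "sqdist_n n y u \<le> sqdist_n n y v" if "v \<in> mono_cone n" for v
      using pyth[OF that] sum_nonneg[of "{..<n}" "\<lambda>i. (u i - v i)^2"] by (simp add: sqdist_n_def)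
    then show "?r \<in> mono_cone n \<and> (\<forall>v\<in>mono_cone n. sqdist_n n y ?r \<le> sqdist_n n y v)"
      using rc r by simp
  next
    fix v assume v: "v \<in> mono_cone n \<and> (\<forall>w\<in>mono_cone n. sqdist_n n y v \<le> sqdist_n n y w)"
    then have "sqdist_n n y v \<le> sqdist_n n y u" using rc r by metis
    then have "sqdist_n n u v \<le> 0" using pyth[of v] v by simp
    then have "(\<Sum>i<n. (u i - v i)^2) = 0"
      using sum_nonneg[of "{..<n}" "\<lambda>i. (u i - v i)^2"] by (simp add: sqdist_n_def)
    then have "\<forall>i<n. u i = v i" by (simp add: sum_nonneg_eq_0_iff)
    then show "v = ?r" using v by (auto simp: mono_cone_def extensional_def restrict_def fun_eq_iff)
  qed
qed

text \<open>Replaces the projection by finitely many inequalities between partial sums of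
  \<open>y\<close>, the form in which measurability and exchangeability are used.\<close>

lemma num_pieces_iso_proj: "num_pieces n (iso_proj n y) = card (vertices n y)"
proof -
  obtain u where "isotonic_fit n y u" using isotonic_fit_exists by blast
  then show ?thesis
    by (simp add: num_pieces_def iso_proj_eq_isotonic_fit isotonic_fit_card_image)
qed

section \<open>Cutting out a face\<close>

text \<open>Acts on indices: for \<open>a + l <= m\<close> it permutes those below \<open>m\<close>,
  so composing a sample with it keeps the law of i.i.d. increments. The first \<open>m - l\<close>
  places then carry the walk with the block cut out.\<close>

definition block_to_end :: "nat \<Rightarrow> nat \<Rightarrow> nat \<Rightarrow> nat \<Rightarrow> nat" where
  "block_to_end m a l i = (if i < a then i else if i < m - l then i + l else i - (m - l) + a)"

definition rotate_tail :: "nat \<Rightarrow> nat \<Rightarrow> nat \<Rightarrow> nat \<Rightarrow> nat" where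
  "rotate_tail p l r i = (if i < p then i else p + (i - p + r) mod l)"

text \<open>The inequality is weak, which is all that a face provides; that two different rotations
  do not satisfy it together is shown almost surely.\<close>

definition tail_above_chord :: "nat \<Rightarrow> nat \<Rightarrow> (nat \<Rightarrow> real) \<Rightarrow> bool" where
  "tail_above_chord p l w \<longleftrightarrow> (\<forall>i\<in>{..l}.
     (sum w {..<p + l} - sum w {..<p}) * real i \<le> real l * (sum w {..<p + i} - sum w {..<p}))"

text \<open>The slope of the last \<open>l\<close> steps is multiplied by \<open>l\<close> here and in \<open>tail_above_chord\<close> to avoid division.\<close>
definition tilted_min_at :: "nat \<Rightarrow> nat \<Rightarrow> nat \<Rightarrow> (nat \<Rightarrow> real) \<Rightarrow> bool" where
  "tilted_min_at p l a w \<longleftrightarrow> (\<forall>k\<in>{..p}. k \<noteq> a \<longrightarrow>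
     real l * sum w {..<a} - (sum w {..<p + l} - sum w {..<p}) * real a
       < real l * sum w {..<k} - (sum w {..<p + l} - sum w {..<p}) * real k)"

lemma sum_lessThan_cong:
  fixes g h :: "nat \<Rightarrow> real"
  shows "(\<And>i. i < k \<Longrightarrow> g i = h i) \<Longrightarrow> sum g {..<k} = sum h {..<k}"
  by (rule sum.cong) auto

lemma vertices_cong: "(\<And>i. i < m \<Longrightarrow> y i = z i) \<Longrightarrow> vertices m y = vertices m z"
proof -
  assume *: "\<And>i. i < m \<Longrightarrow> y i = z i"
  have "sum y {..<k} = sum z {..<k}" if "k \<le> m" for k
    using * that by (intro sum_lessThan_cong) auto
  then show ?thesis unfolding vertices_def
    by (intro Collect_cong conj_cong refl ball_cong) (auto simp del: sum.lessThan_Suc)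
qed

lemma block_to_end_sum_le:
  assumes "k \<le> a" "a + l \<le> m"
  shows "sum (\<lambda>i. g (block_to_end m a l i)) {..<k} = (sum g {..<k} :: real)"
  using assms by (intro sum_lessThan_cong) (auto simp: block_to_end_def)

lemma block_to_end_sum_ge:
  assumes "a \<le> k" "k \<le> m - l" "a + l \<le> m"
  shows "sum (\<lambda>i. g (block_to_end m a l i)) {..<k}
    = sum g {..<a} + (sum g {..<k + l} - (sum g {..<a + l} :: real))"
proof -
  obtain d where d: "k = a + d" using assms(1) le_Suc_ex by blast
  have "sum (\<lambda>i. g (block_to_end m a l i)) {..<a + d}
      = sum g {..<a} + (\<Sum>i<d. g (block_to_end m a l (a + i)))"
    by (subst sum_lessThan_add) (simp add: block_to_end_sum_le assms)
  also have "(\<Sum>i<d. g (block_to_end m a l (a + i))) = (\<Sum>i<d. g (a + l + i))"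
    using d assms by (intro sum_lessThan_cong) (auto simp: block_to_end_def ac_simps)
  also have "\<dots> = sum g {..<k + l} - sum g {..<a + l}"
    using sum_lessThan_add[of g "a + l" d] by (simp add: d ac_simps)
  finally show ?thesis by (simp add: d)
qed

lemma block_to_end_sum_tail:
  assumes "a + l \<le> m" "i \<le> l"
  shows "sum (\<lambda>i. g (block_to_end m a l i)) {..<m - l + i}
    - sum (\<lambda>i. g (block_to_end m a l i)) {..<m - l}
    = sum g {..<a + i} - (sum g {..<a} :: real)"
proof -
  have "(\<Sum>j<i. g (block_to_end m a l (m - l + j))) = (\<Sum>j<i. g (a + j))"
    using assms by (intro sum_lessThan_cong) (auto simp: block_to_end_def ac_simps)
  then show ?thesis by (simp add: sum_lessThan_add)
qed

text \<open>Deleting the face from \<open>u\<close> leaves \<open>v\<close>, a fit of the shortened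
  walk \<open>w\<close>, with exactly one value less. Over the face \<open>u\<close> has straight
  partial sums lying below those of \<open>y\<close>, whence the chord condition. Tilted by the
  slope \<open>s\<close>, the partial sums of \<open>v\<close> strictly decrease up to
  \<open>a\<close> and strictly increase afterwards; those of \<open>w\<close> dominate them and
  agree at \<open>a\<close>, so the tilted minimum of \<open>w\<close> at \<open>a\<close> is
  strict.\<close>

lemma face_decomposition:
  assumes fit: "isotonic_fit m y u" and al: "a + l \<le> m" and l: "0 < l"
    and lo: "\<And>i. i < a \<Longrightarrow> u i < s" and eq: "\<And>i. a \<le> i \<Longrightarrow> i < a + l \<Longrightarrow> u i = s"
    and hi: "\<And>i. a + l \<le> i \<Longrightarrow> i < m \<Longrightarrow> s < u i"
    and ta: "sum u {..<a} = sum y {..<a}" and tb: "sum u {..<a + l} = sum y {..<a + l}"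
  defines "w \<equiv> \<lambda>i. y (block_to_end m a l i)"
  shows "tail_above_chord (m - l) l w" "tilted_min_at (m - l) l a w"
    "card (vertices m y) = Suc (card (vertices (m - l) w))"
proof -
  define v where "v = (\<lambda>i. u (block_to_end m a l i))"
  define p where "p = m - l"
  have p: "a \<le> p" "p + l = m" using al by (auto simp: p_def)
  have us: "sum u {..<a + i} - sum u {..<a} = s * real i" if "i \<le> l" for i
    using that eq by (simp add: sum_lessThan_add)
  have D: "sum w {..<p + l} - sum w {..<p} = real l * s"
    using block_to_end_sum_tail[OF al, of l y] us[of l] ta tb by (simp add: w_def p_def)
  have Di: "s * real i \<le> sum w {..<p + i} - sum w {..<p}" if "i \<le> l" for i
    using block_to_end_sum_tail[OF al that, of y] us[OF that] ta
      isotonic_fit_le[OF fit, of "a + i"] that al by (simp add: w_def p_def)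
  show "tail_above_chord (m - l) l w"
    unfolding tail_above_chord_def p_def[symmetric] D
    using mult_left_mono[OF Di, of _ "real l"] by (auto simp: ac_simps)
  have vlo: "v i < s" if "i < a" for i using that lo by (simp add: v_def block_to_end_def)
  have vhi: "s < v i" if "a \<le> i" "i < p" for i
    using that hi[of "i + l"] p by (simp add: v_def block_to_end_def p_def)
  have le: "sum v {..<k} \<le> sum w {..<k}" if "k \<le> p" for k
  proof (cases "k \<le> a")
    case True
    then show ?thesis using isotonic_fit_le[OF fit, of k] al
      by (simp add: v_def w_def block_to_end_sum_le)
  next
    case False
    then show ?thesis using isotonic_fit_le[OF fit, of "k + l"] that p al ta tb
      by (simp add: v_def w_def block_to_end_sum_ge)
  qed
  have eqa: "sum v {..<a} = sum w {..<a}" using ta al by (simp add: v_def w_def block_to_end_sum_le)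
  show "tilted_min_at (m - l) l a w"
    unfolding tilted_min_at_def p_def[symmetric] D
  proof (intro ballI impI)
    fix k assume k: "k \<in> {..p}" "k \<noteq> a"
    have "sum v {..<a} - s * real a < sum v {..<k} - s * real k"
    proof (cases "k < a")
      case True
      then have "sum v {k..<a} < sum (\<lambda>_. s) {k..<a}"
        using vlo by (intro sum_strict_mono) auto
      then show ?thesis using True sum.atLeastLessThan_concat[of 0 k a v]
        by (simp add: atLeast0LessThan algebra_simps of_nat_diff)
    next
      case False
      then have "sum (\<lambda>_. s) {a..<k} < sum v {a..<k}"
        using vhi k by (intro sum_strict_mono) auto
      then show ?thesis using False sum.atLeastLessThan_concat[of 0 a k v]
        by (simp add: atLeast0LessThan algebra_simps of_nat_diff)
    qed
    then have "sum w {..<a} - s * real a < sum w {..<k} - s * real k"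
      using eqa le[of k] k by simp
    then have "real l * (sum w {..<a} - s * real a) < real l * (sum w {..<k} - s * real k)"
      using l by simp
    then show "real l * sum w {..<a} - real l * s * real a < real l * sum w {..<k} - real l * s * real k"
      by (simp add: algebra_simps)
  qed
  have "isotonic_fit p w v"
    unfolding isotonic_fit_def
  proof (intro conjI allI impI)
    fix i j assume "i \<le> j" "j < p"
    then show "v i \<le> v j"
      using isotonic_fit_mono[OF fit] p by (auto simp: v_def block_to_end_def p_def)
  next
    fix k assume "k \<le> p" and sep: "\<forall>i<k. \<forall>j\<in>{k..<p}. v i < v j"
    show "sum v {..<k} = sum w {..<k}"
    proof (cases "k \<le> a")
      case True
      have "sum u {..<k} = sum y {..<k}"
      \<comment> \<open>At \<open>k = a\<close> touching is a hypothesis on the face; for smaller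
        \<open>k\<close> a jump of \<open>v\<close> at \<open>k\<close> is already one of
        \<open>u\<close>.\<close>
      proof (cases "k = a")
        case False
        show ?thesis
        proof (rule isotonic_fit_eq[OF fit])
          fix i j assume ij: "i < k" "k \<le> j" "j < m"
          have "u i < u k" using sep[rule_format, of i k] True False ij p
            by (auto simp: v_def block_to_end_def)
          also have "u k \<le> u j" using isotonic_fit_mono[OF fit] ij by simp
          finally show "u i < u j" .
        qed (use True al in auto)
      qed (use ta in simp)
      then show ?thesis using True al by (simp add: v_def w_def block_to_end_sum_le)
    next
      case False
      \<comment> \<open>Beyond the cut, place \<open>k\<close> of the shortened walk is place
        \<open>k + l\<close> of \<open>y\<close>.\<close>
      have "sum u {..<k + l} = sum y {..<k + l}"
      proof (rule isotonic_fit_eq[OF fit])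
        fix i j assume ij: "i < k + l" "k + l \<le> j" "j < m"
        have "u i \<le> u (k - 1 + l)" using isotonic_fit_mono[OF fit] ij False by simp
        also have "u (k - 1 + l) = v (k - 1)" using False \<open>k \<le> p\<close>
          by (auto simp: v_def block_to_end_def p_def)
        also have "\<dots> < v (j - l)"
        proof -
          have "k - 1 < k" "k \<le> j - l" "j - l < p" using False ij p by auto
          then show ?thesis using sep by simp
        qed
        also have "v (j - l) = u j" using False ij p
          by (auto simp: v_def block_to_end_def p_def)
        finally show "u i < u j" .
      qed (use \<open>k \<le> p\<close> p in auto)
      then show ?thesis using False \<open>k \<le> p\<close> p al ta tb
        by (simp add: v_def w_def block_to_end_sum_ge)
    qed
  qed (use le in auto)
  then have "card (vertices p w) = card (v ` {..<p})" by (simp add: isotonic_fit_card_image)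
  moreover have "u ` {..<m} = insert s (v ` {..<p})"
  proof (intro set_eqI iffI)
    fix x assume "x \<in> u ` {..<m}"
    then obtain i where i: "i < m" "x = u i" by auto
    consider "i < a" | "a \<le> i" "i < a + l" | "a + l \<le> i" by linarith
    then show "x \<in> insert s (v ` {..<p})"
    proof cases
      case 1
      then have "x = v i" using i by (simp add: v_def block_to_end_def)
      then show ?thesis using 1 p by auto
    next
      case 2
      then show ?thesis using eq i by simp
    next
      case 3
      then have "x = v (i - l)" "i - l < p" using i p by (auto simp: v_def block_to_end_def p_def)
      then show ?thesis by auto
    qed
  next
    fix x assume "x \<in> insert s (v ` {..<p})"
    moreover have "s \<in> u ` {..<m}" using eq[of a] l al by force
    ultimately show "x \<in> u ` {..<m}" using p by (auto simp: v_def block_to_end_def p_def)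
  qed
  moreover have "s \<noteq> v i" if "i < p" for i
    using vlo[of i] vhi[of i] that by (cases "i < a") auto
  then have "s \<notin> v ` {..<p}" by auto
  ultimately show "card (vertices m y) = Suc (card (vertices (m - l) w))"
    using isotonic_fit_card_image[OF fit] by (simp add: p_def)
qed

text \<open>The lengths of the faces add up to \<open>m\<close>, and by
  \<open>face_decomposition\<close> each face gives a summand with both conditions satisfied. The
  other pairs \<open>(l, a)\<close> only add nonnegative terms, hence an inequality.\<close>

lemma face_count_inequality:
  fixes f :: "nat \<Rightarrow> ennreal"
  shows "of_nat m * f (card (vertices m y)) \<le>
    (\<Sum>l\<in>{1..m}. \<Sum>a\<in>{..m - l}. of_nat l *
       (let w = \<lambda>i. y (block_to_end m a l i) in
        if tail_above_chord (m - l) l w \<and> tilted_min_at (m - l) l a w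
        then f (Suc (card (vertices (m - l) w))) else 0))"
    (is "_ \<le> (\<Sum>l\<in>_. \<Sum>a\<in>_. ?h l a)")
proof -
  define g where "g = ?h"
  obtain u where fit: "isotonic_fit m y u" using isotonic_fit_exists by blast
  let ?V = "u ` {..<m}"
  let ?K = "card (vertices m y)"
  \<comment> \<open>Here \<open>x\<close> is the pair of length and start of the level set of
    \<open>s\<close>; including its summand in \<open>Q\<close> lets a single choice supply
    everything.\<close>
  define Q where "Q s x \<longleftrightarrow> 0 < fst x \<and> snd x + fst x \<le> m \<and>
    {i\<in>{..<m}. u i = s} = {snd x..<snd x + fst x} \<and> g (fst x) (snd x) = of_nat (fst x) * f ?K"
    for s and x :: "nat \<times> nat"
  have ex: "\<exists>x. Q s x" if s: "s \<in> ?V" for s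
  proof -
    obtain a b where ab: "a < b" "b \<le> m" "\<And>i. i < a \<Longrightarrow> u i < s"
        "\<And>i. a \<le> i \<Longrightarrow> i < b \<Longrightarrow> u i = s" "\<And>i. b \<le> i \<Longrightarrow> i < m \<Longrightarrow> s < u i"
        "sum u {..<a} = sum y {..<a}" "sum u {..<b} = sum y {..<b}"
      using isotonic_fit_level[OF fit s] by blast
    define l where "l = b - a"
    have b: "b = a + l" "0 < l" using ab(1) by (auto simp: l_def)
    have "{i\<in>{..<m}. u i = s} = {a..<a + l}"
    proof (intro set_eqI iffI)
      fix i assume "i \<in> {i\<in>{..<m}. u i = s}"
      then show "i \<in> {a..<a + l}" using ab(3)[of i] ab(5)[of i] b by force
    next
      fix i assume "i \<in> {a..<a + l}"
      then show "i \<in> {i\<in>{..<m}. u i = s}" using ab(4)[of i] ab(2) b by auto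
    qed
    moreover have "g l a = of_nat l * f ?K"
      using face_decomposition[OF fit ab(2)[unfolded b] b(2) ab(3) ab(4)[unfolded b] ab(5)[unfolded b] ab(6) ab(7)[unfolded b]]
      by (simp add: g_def Let_def)
    ultimately have "Q s (l, a)" using ab(2) b by (simp add: Q_def)
    then show ?thesis ..
  qed
  define L where "L s = fst (SOME x. Q s x)" for s
  define A where "A s = snd (SOME x. Q s x)" for s
  have LA: "0 < L s" "A s + L s \<le> m" "{i\<in>{..<m}. u i = s} = {A s..<A s + L s}"
    "g (L s) (A s) = of_nat (L s) * f ?K" if "s \<in> ?V" for s
    using someI_ex[OF ex[OF that]] unfolding L_def A_def Q_def by blast+
  have "m = card (\<Union>s\<in>?V. {i\<in>{..<m}. u i = s})"
    by (subst card_lessThan[of m, symmetric], rule arg_cong[where f = card]) auto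
  also have "\<dots> = (\<Sum>s\<in>?V. card {i\<in>{..<m}. u i = s})"
    by (intro card_UN_disjoint) auto
  also have "\<dots> = (\<Sum>s\<in>?V. L s)"
    by (intro sum.cong refl) (simp only: LA(3) card_atLeastLessThan diff_add_inverse)
  finally have m: "m = (\<Sum>s\<in>?V. L s)" .
  have inj: "inj_on (\<lambda>s. (L s, A s)) ?V"
  proof (rule inj_onI)
    fix s t assume st: "s \<in> ?V" "t \<in> ?V" "(L s, A s) = (L t, A t)"
    then have "{i\<in>{..<m}. u i = s} = {i\<in>{..<m}. u i = t}" using LA(3)[OF st(1)] LA(3)[OF st(2)] by simp
    then show "s = t" using st(1) by auto
  qed
  have "of_nat m * f ?K = (\<Sum>s\<in>?V. of_nat (L s) * f ?K)"
    by (subst m) (simp add: sum_distrib_right)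
  also have "\<dots> = (\<Sum>s\<in>?V. (\<lambda>(l, a). g l a) (L s, A s))"
    by (intro sum.cong refl) (simp add: LA(4))
  also have "\<dots> = (\<Sum>x\<in>(\<lambda>s. (L s, A s)) ` ?V. (\<lambda>(l, a). g l a) x)"
    by (subst sum.reindex[OF inj]) simp
  also have "\<dots> \<le> (\<Sum>x\<in>Sigma {1..m} (\<lambda>l. {..m - l}). (\<lambda>(l, a). g l a) x)"
  proof (intro sum_mono2)
    show "(\<lambda>s. (L s, A s)) ` ?V \<subseteq> Sigma {1..m} (\<lambda>l. {..m - l})"
      using LA(1,2) by fastforce
  qed auto
  also have "\<dots> = (\<Sum>l\<in>{1..m}. \<Sum>a\<in>{..m - l}. g l a)"
    by (subst sum.Sigma) auto
  finally show ?thesis by (simp add: g_def)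
qed

section \<open>Uniqueness of the insertion place and of the rotation\<close>

lemma tilted_min_at_unique:
  "tilted_min_at p l a w \<Longrightarrow> tilted_min_at p l b w \<Longrightarrow> a \<le> p \<Longrightarrow> b \<le> p \<Longrightarrow> a = b"
  unfolding tilted_min_at_def by (metis atMost_iff less_asym)

text \<open>Uniqueness part of the cycle lemma. The chord condition of rotation \<open>r\<close>
  after \<open>d = r' - r\<close> steps bounds the arc from \<open>r\<close> to \<open>r'\<close>
  from below. That of \<open>r'\<close> after \<open>l - d\<close> steps bounds the complementary
  arc from below, hence the first arc from above, by the same value.\<close>

lemma tail_above_chord_rotations_tie:
  assumes "r < r'" "r' < l"
    and 1: "tail_above_chord p l (\<lambda>i. w (rotate_tail p l r i))"
    and 2: "tail_above_chord p l (\<lambda>i. w (rotate_tail p l r' i))"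
  shows "real l * (sum w {..<p + r'} - sum w {..<p + r})
    = (sum w {..<p + l} - sum w {..<p}) * (real r' - real r)"
proof -
  define d where "d = r' - r"
  have d: "r' = r + d" "0 < d" "d < l" using assms by (auto simp: d_def)
  have rot: "sum (\<lambda>i. w (rotate_tail p l q i)) {..<p + k} = sum w {..<p} + (\<Sum>j<k. w (p + (j + q) mod l))"
    for q k
  proof -
    have "sum (\<lambda>i. w (rotate_tail p l q i)) {..<p} = sum w {..<p}"
      by (intro sum_lessThan_cong) (simp add: rotate_tail_def)
    then show ?thesis by (simp add: sum_lessThan_add) (simp add: rotate_tail_def)
  qed
  \<comment> \<open>The rotated block wraps around after \<open>l - q\<close> steps; its total is
    unchanged.\<close>
  have tot: "(\<Sum>j<l. w (p + (j + q) mod l)) = sum w {..<p + l} - sum w {..<p}" if "q < l" for q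
  proof -
    have l: "l = (l - q) + q" using that by simp
    have "(\<Sum>j<l. w (p + (j + q) mod l)) = (\<Sum>j<l - q. w (p + (j + q) mod l)) + (\<Sum>j<q. w (p + (l - q + j + q) mod l))"
      by (subst l, subst sum_lessThan_add) (use that in simp)
    also have "(\<Sum>j<l - q. w (p + (j + q) mod l)) = (\<Sum>j<l - q. w (p + q + j))"
      using that by (intro sum_lessThan_cong) (simp add: ac_simps)
    also have "(\<Sum>j<q. w (p + (l - q + j + q) mod l)) = (\<Sum>j<q. w (p + j))"
      using that by (intro sum_lessThan_cong) simp
    also have "(\<Sum>j<l - q. w (p + q + j)) + (\<Sum>j<q. w (p + j)) = sum w {..<p + l} - sum w {..<p}"
      using sum_lessThan_add[of w "p + q" "l - q"] sum_lessThan_add[of w p q] that by simp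
    finally show ?thesis .
  qed
  let ?D = "sum w {..<p + l} - sum w {..<p}"
  let ?E = "sum w {..<p + r'} - sum w {..<p + r}"
  have E: "?E = (\<Sum>j<d. w (p + r + j))"
    using sum_lessThan_add[of w "p + r" d] d by (simp add: ac_simps)
  have "?D * real d \<le> real l * (\<Sum>j<d. w (p + (j + r) mod l))"
    using 1[unfolded tail_above_chord_def rot, rule_format, of d] d assms rot[of r 0] tot[of r] by simp
  also have "(\<Sum>j<d. w (p + (j + r) mod l)) = ?E"
    unfolding E using d assms by (intro sum_lessThan_cong) (simp add: ac_simps)
  finally have le: "?D * real d \<le> real l * ?E" .
  have "?D * real (l - d) \<le> real l * (\<Sum>j<l - d. w (p + (j + r') mod l))"
    using 2[unfolded tail_above_chord_def rot, rule_format, of "l - d"] d assms rot[of r' 0] tot[of r'] by simp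
  also have "(\<Sum>j<l - d. w (p + (j + r') mod l)) = ?D - ?E"
  proof -
    have "?D = (\<Sum>j<l - d. w (p + (j + r') mod l)) + (\<Sum>j<d. w (p + (l - d + j + r') mod l))"
      using tot[of r'] assms sum_lessThan_add[of "\<lambda>j. w (p + (j + r') mod l)" "l - d" d] d by simp
    also have "(\<Sum>j<d. w (p + (l - d + j + r') mod l)) = ?E"
      unfolding E
    proof (intro sum_lessThan_cong)
      fix j assume "j < d"
      then have "l - d + j + r' = r + j + l" "r + j < l" using d assms by auto
      then have "(l - d + j + r') mod l = r + j" by (simp only: mod_add_self2 mod_less)
      then show "w (p + (l - d + j + r') mod l) = w (p + r + j)" by (simp add: ac_simps)
    qed
    finally show ?thesis by simp
  qed
  finally have "real l * ?E \<le> ?D * real d" using d by (simp add: of_nat_diff algebra_simps)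
  then show ?thesis using le d by simp
qed

section \<open>Walks with independent identically distributed increments\<close>

lemma tail_above_chord_cong:
  assumes "\<And>i. i < p + l \<Longrightarrow> w i = w' i"
  shows "tail_above_chord p l w = tail_above_chord p l w'"
proof -
  have "sum w {..<k} = sum w' {..<k}" if "k \<le> p + l" for k
    using assms that by (intro sum_lessThan_cong) auto
  then show ?thesis unfolding tail_above_chord_def by simp
qed

lemma tilted_min_at_cong:
  assumes "\<And>i. i < p + l \<Longrightarrow> w i = w' i" "a \<le> p"
  shows "tilted_min_at p l a w = tilted_min_at p l a w'"
proof -
  have "sum w {..<k} = sum w' {..<k}" if "k \<le> p + l" for k
    using assms that by (intro sum_lessThan_cong) auto
  then show ?thesis using assms(2) unfolding tilted_min_at_def by simp
qed

lemma inj_on_block_to_end: "a + l \<le> m \<Longrightarrow> inj_on (block_to_end m a l) {..<m}"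
  by (auto simp: inj_on_def block_to_end_def split: if_splits)

lemma block_to_end_less: "a + l \<le> m \<Longrightarrow> i < m \<Longrightarrow> block_to_end m a l i < m"
  by (auto simp: block_to_end_def)

lemma inj_on_rotate_tail: "inj_on (rotate_tail p l r) {..<p + l}"
proof (rule inj_onI)
  have *: "x = y" if "(x + r) mod l = (y + r) mod l" "x \<le> y" "y < l" for x y
  proof -
    have "l dvd (y + r) - (x + r)"
      using that by (subst mod_eq_dvd_iff_nat[symmetric]) auto
    then have "l dvd y - x" by simp
    then show ?thesis using that by (auto dest: dvd_imp_le)
  qed
  fix i j assume ij: "i \<in> {..<p + l}" "j \<in> {..<p + l}" and eq: "rotate_tail p l r i = rotate_tail p l r j"
  consider "i < p \<or> j < p" | "p \<le> i" "p \<le> j" by linarith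
  then show "i = j"
  proof cases
    case 1
    then show ?thesis using eq by (auto simp: rotate_tail_def split: if_splits)
  next
    case 2
    then have "(i - p + r) mod l = (j - p + r) mod l" "i - p < l" "j - p < l"
      using eq ij by (auto simp: rotate_tail_def)
    then have "i - p = j - p"
      using *[of "i - p" "j - p"] *[of "j - p" "i - p"] by (cases "i - p \<le> j - p") auto
    then show ?thesis using 2 by simp
  qed
qed

lemma rotate_tail_less: "0 < l \<Longrightarrow> i < p + l \<Longrightarrow> rotate_tail p l r i < p + l"
  by (auto simp: rotate_tail_def)

text \<open>As \<open>t\<close> is merely injective, this covers both permutations of the
  coordinates and marginals on some of them.\<close>

lemma nn_integral_PiM_reindex:
  assumes "\<And>i. i \<in> K \<Longrightarrow> prob_space (M i)" "inj_on t I" "t \<in> I \<rightarrow> K"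
    and h: "h \<in> borel_measurable (PiM I (\<lambda>i. M (t i)))"
  shows "(\<integral>\<^sup>+\<omega>. h (\<lambda>i\<in>I. \<omega> (t i)) \<partial>PiM K M) = (\<integral>\<^sup>+\<omega>. h \<omega> \<partial>PiM I (\<lambda>i. M (t i)))"
proof -
  have m: "(\<lambda>\<omega>. \<lambda>i\<in>I. \<omega> (t i)) \<in> measurable (PiM K M) (PiM I (\<lambda>i. M (t i)))"
    using assms(3) by (intro measurable_restrict measurable_component_singleton) auto
  show ?thesis
    by (subst distr_PiM_reindex[symmetric, OF assms(1,2,3)]) (simp_all add: nn_integral_distr[OF m] h)
qed

lemma sum_at_most_one_le:
  fixes x :: ennreal
  assumes "finite A" "\<And>a b. a \<in> A \<Longrightarrow> b \<in> A \<Longrightarrow> P a \<Longrightarrow> P b \<Longrightarrow> a = b"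
  shows "(\<Sum>a\<in>A. if P a then x else 0) \<le> x"
proof (cases "\<exists>a\<in>A. P a")
  case True
  then obtain a where a: "a \<in> A" "P a" by blast
  then have "(\<Sum>b\<in>A. if P b then x else 0) = (\<Sum>b\<in>{a}. x)"
    using assms by (intro sum.mono_neutral_cong_right) auto
  then show ?thesis by simp
qed (simp add: sum.neutral)

locale atomless_real_distribution = prob_space N for N :: "real measure" +
  assumes sets_N [measurable_cong, simp]: "sets N = sets borel"
    and atomless: "emeasure N {x} = 0"
begin

abbreviation sample :: "nat \<Rightarrow> (nat \<Rightarrow> real) measure" where
  "sample m \<equiv> PiM {..<m} (\<lambda>_. N)"

lemma nn_integral_sample_reindex:
  assumes "inj_on t {..<p}" "\<And>i. i < p \<Longrightarrow> t i < m" "h \<in> borel_measurable (sample p)"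
  shows "(\<integral>\<^sup>+\<omega>. h (\<lambda>i\<in>{..<p}. \<omega> (t i)) \<partial>sample m) = (\<integral>\<^sup>+\<omega>. h \<omega> \<partial>sample p)"
  by (rule nn_integral_PiM_reindex) (use assms prob_space_axioms in auto)

text \<open>Fubini in the coordinate \<open>j\<close>: with the others fixed, the equation has a
  single solution because \<open>c j\<close> is nonzero, and a point has mass zero.\<close>

lemma AE_hyperplane:
  assumes "finite I" "j \<in> I" "c j \<noteq> 0"
  shows "AE \<omega> in PiM I (\<lambda>_. N). (\<Sum>i\<in>I. c i * \<omega> i) \<noteq> 0"
proof -
  interpret product_sigma_finite "\<lambda>_. N" by unfold_locales
  define J where "J = I - {j}"
  have J: "finite J" "j \<notin> J" "I = insert j J" using assms by (auto simp: J_def)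
  let ?A = "{\<omega> \<in> space (PiM I (\<lambda>_. N)). (\<Sum>i\<in>I. c i * \<omega> i) = 0}"
  have A: "?A \<in> sets (PiM (insert j J) (\<lambda>_. N))"
    unfolding J(3)[symmetric] using assms(1) by measurable
  have "emeasure (PiM I (\<lambda>_. N)) ?A = (\<integral>\<^sup>+x. indicator ?A x \<partial>PiM (insert j J) (\<lambda>_. N))"
    using A J(3) by simp
  also have "\<dots> = (\<integral>\<^sup>+x. \<integral>\<^sup>+y. indicator ?A (x(j := y)) \<partial>N \<partial>PiM J (\<lambda>_. N))"
    using A by (intro product_nn_integral_insert J borel_measurable_indicator)
  also have "\<dots> = (\<integral>\<^sup>+x. 0 \<partial>PiM J (\<lambda>_. N))"
  proof (rule nn_integral_cong)
    fix x :: "_ \<Rightarrow> real"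
    let ?z = "- (\<Sum>i\<in>J. c i * x i) / c j"
    have "(\<Sum>i\<in>I. c i * (x(j := y)) i) = c j * y + (\<Sum>i\<in>J. c i * x i)" for y
      unfolding J(3) using J(1,2) by (subst sum.insert) (auto intro!: sum.cong)
    then have "indicator ?A (x(j := y)) \<le> (indicator {?z} y :: ennreal)" for y
      using assms(3) by (auto simp: indicator_def field_simps)
    then have "(\<integral>\<^sup>+y. indicator ?A (x(j := y)) \<partial>N) \<le> (\<integral>\<^sup>+y. indicator {?z} y \<partial>N)"
      by (intro nn_integral_mono) auto
    also have "\<dots> = 0" by (simp add: atomless)
    finally show "(\<integral>\<^sup>+y. indicator ?A (x(j := y)) \<partial>N) = 0" by simp
  qed
  finally have "emeasure (PiM I (\<lambda>_. N)) ?A = 0" by simp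
  then show ?thesis using A J(3) by (intro AE_I[of _ _ ?A]) auto
qed

lemma measurable_partial_sum:
  "k \<le> m \<Longrightarrow> (\<lambda>\<omega>. sum \<omega> {..<k}) \<in> borel_measurable (sample m)"
proof (intro borel_measurable_sum)
  fix i assume "k \<le> m" "i \<in> {..<k}"
  then have "(\<lambda>\<omega>. \<omega> i) \<in> measurable (sample m) N" by (intro measurable_component_singleton) auto
  then show "(\<lambda>\<omega>. \<omega> i) \<in> borel_measurable (sample m)"
    using measurable_cong_sets[OF refl sets_N] by blast
qed

lemma measurable_tail_above_chord:
  "p + l \<le> m \<Longrightarrow> Measurable.pred (sample m) (tail_above_chord p l)"
  unfolding tail_above_chord_def
  by (intro pred_intros_finite borel_measurable_le[folded pred_def] borel_measurable_times borel_measurable_diff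
      borel_measurable_const measurable_partial_sum finite_atMost) auto

lemma measurable_tilted_min_at:
  "p + l \<le> m \<Longrightarrow> a \<le> p \<Longrightarrow> Measurable.pred (sample m) (tilted_min_at p l a)"
  unfolding tilted_min_at_def
  by (intro pred_intros_finite pred_intros_imp' borel_measurable_less borel_measurable_times borel_measurable_diff
      borel_measurable_const measurable_partial_sum finite_atMost) auto

lemma measurable_card_vertices:
  assumes "p \<le> m"
  shows "(\<lambda>\<omega>. card (vertices p \<omega>)) \<in> measurable (sample m) (count_space UNIV)"
proof -
  have "Measurable.pred (sample m) (\<lambda>\<omega>. i \<in> vertices p \<omega>)" if "i < p" for i
  proof -
    have "Measurable.pred (sample m) (\<lambda>\<omega>. \<forall>a\<in>{..i}. \<forall>b\<in>{Suc i<..p}.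
       (sum \<omega> {..<Suc i} - sum \<omega> {..<a}) * (real b - real (Suc i))
       < (sum \<omega> {..<b} - sum \<omega> {..<Suc i}) * (real (Suc i) - real a))"
      using that assms
      by (intro pred_intros_finite borel_measurable_less borel_measurable_times borel_measurable_diff
          borel_measurable_const measurable_partial_sum) auto
    then show ?thesis using that by (simp add: vertices_def)
  qed
  then have "(\<lambda>\<omega>. \<Sum>i<p. if i \<in> vertices p \<omega> then 1 else 0 :: nat) \<in> measurable (sample m) (count_space UNIV)"
    by (intro measurable_sum_nat measurable_If measurable_const) auto
  moreover have "card (vertices p \<omega>) = (\<Sum>i<p. if i \<in> vertices p \<omega> then 1 else 0)" for \<omega>
    by (simp add: sum.If_cases Int_def) (auto simp: vertices_def intro!: arg_cong[where f = card])
  ultimately show ?thesis by simp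
qed

text \<open>Two such rotations would force the linear equation of
  \<open>tail_above_chord_rotations_tie\<close>, whose solutions form a null hyperplane.\<close>

lemma AE_tail_above_chord_rotations:
  assumes "p + l = m"
  shows "AE \<omega> in sample m. \<forall>r\<in>{..<l}. \<forall>r'\<in>{..<l}.
    tail_above_chord p l (\<lambda>i. \<omega> (rotate_tail p l r i)) \<longrightarrow>
    tail_above_chord p l (\<lambda>i. \<omega> (rotate_tail p l r' i)) \<longrightarrow> r = r'"
proof -
  have "AE \<omega> in sample m. real l * (sum \<omega> {..<p + r'} - sum \<omega> {..<p + r})
    \<noteq> (sum \<omega> {..<p + l} - sum \<omega> {..<p}) * (real r' - real r)" if r: "r < r'" "r' < l" for r r'
  proof -
    define c where "c i = (if p + r \<le> i \<and> i < p + r' then real l else 0)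
      - (if p \<le> i then real r' - real r else 0)" for i
    have *: "(\<Sum>i<m. (if a \<le> i \<and> i < b then x else 0) * \<omega> i) = x * (sum \<omega> {..<b} - sum \<omega> {..<a})"
      if "a \<le> b" "b \<le> m" for a b x and \<omega> :: "nat \<Rightarrow> real"
    proof -
      have "(\<Sum>i<m. (if a \<le> i \<and> i < b then x else 0) * \<omega> i) = (\<Sum>i\<in>{a..<b}. x * \<omega> i)"
        using that by (intro sum.mono_neutral_cong_right) auto
      also have "\<dots> = x * (sum \<omega> {..<b} - sum \<omega> {..<a})"
        using sum.atLeastLessThan_concat[of 0 a b \<omega>] that
        by (simp add: sum_distrib_left[symmetric] atLeast0LessThan[symmetric])
      finally show ?thesis .
    qed
    have lin: "(\<Sum>i<m. c i * \<omega> i) = real l * (sum \<omega> {..<p + r'} - sum \<omega> {..<p + r})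
      - (sum \<omega> {..<p + l} - sum \<omega> {..<p}) * (real r' - real r)" for \<omega>
    proof -
      have "(\<Sum>i<m. c i * \<omega> i) = (\<Sum>i<m. (if p + r \<le> i \<and> i < p + r' then real l else 0) * \<omega> i)
        - (\<Sum>i<m. (if p \<le> i \<and> i < p + l then real r' - real r else 0) * \<omega> i)"
        unfolding sum_subtractf[symmetric] using assms
        by (intro sum.cong refl) (auto simp: c_def algebra_simps)
      also have "(\<Sum>i<m. (if p + r \<le> i \<and> i < p + r' then real l else 0) * \<omega> i)
        = real l * (sum \<omega> {..<p + r'} - sum \<omega> {..<p + r})"
        using r assms by (intro *) auto
      also have "(\<Sum>i<m. (if p \<le> i \<and> i < p + l then real r' - real r else 0) * \<omega> i)
        = (real r' - real r) * (sum \<omega> {..<p + l} - sum \<omega> {..<p})"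
        using assms by (intro *) auto
      finally show ?thesis by simp
    qed
    \<comment> \<open>The coefficient at \<open>p + r\<close> is \<open>l - (r' - r)\<close>,
      positive because \<open>r' < l\<close>.\<close>
    have "AE \<omega> in sample m. (\<Sum>i<m. c i * \<omega> i) \<noteq> 0"
      using r assms by (intro AE_hyperplane[where j = "p + r"]) (auto simp: c_def)
    then show ?thesis by eventually_elim (simp add: lin)
  qed
  then have "AE \<omega> in sample m. \<forall>r\<in>{..<l}. \<forall>r'\<in>{..<l}. r < r' \<longrightarrow>
    real l * (sum \<omega> {..<p + r'} - sum \<omega> {..<p + r})
      \<noteq> (sum \<omega> {..<p + l} - sum \<omega> {..<p}) * (real r' - real r)"
    by (intro AE_finite_allI finite_lessThan AE_impI) auto
  then show ?thesis
  proof eventually_elim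
    case (elim \<omega>)
    show ?case
    proof (intro ballI impI)
      fix r r' assume r: "r \<in> {..<l}" "r' \<in> {..<l}"
        and 1: "tail_above_chord p l (\<lambda>i. \<omega> (rotate_tail p l r i))"
        and 2: "tail_above_chord p l (\<lambda>i. \<omega> (rotate_tail p l r' i))"
      show "r = r'"
      proof (cases r r' rule: linorder_cases)
        case less
        then show ?thesis using tail_above_chord_rotations_tie[OF less _ 1 2] elim r by blast
      next
        case greater
        then show ?thesis using tail_above_chord_rotations_tie[OF greater _ 2 1] elim r by blast
      qed
    qed
  qed
qed

text \<open>Integrates \<open>face_count_inequality\<close>. Moving the block to the end keeps the
  law, so for fixed \<open>l\<close> all \<open>a\<close> refer to one sample; the strict tilted
  minimum sits at no more than one place, which removes the sum over \<open>a\<close>. The factor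
  \<open>l\<close> is spread over the \<open>l\<close> rotations of the tail, of which almost surely
  at most one lies above its chord.\<close>

lemma vertices_recursion:
  fixes f :: "nat \<Rightarrow> ennreal"
  shows "of_nat m * (\<integral>\<^sup>+\<omega>. f (card (vertices m \<omega>)) \<partial>sample m) \<le>
    (\<Sum>l\<in>{1..m}. \<integral>\<^sup>+\<omega>. f (Suc (card (vertices (m - l) \<omega>))) \<partial>sample (m - l))"
proof -
  \<comment> \<open>\<open>G\<close> carries both conditions, \<open>H\<close> drops the tilted
    minimum, \<open>F\<close> also the chord condition; \<open>F l\<close> depends on the first
    \<open>m - l\<close> coordinates only.\<close>
  define F where "F l \<omega> = f (Suc (card (vertices (m - l) \<omega>)))" for l \<omega>
  define H where "H l \<omega> = (if tail_above_chord (m - l) l \<omega> then F l \<omega> else 0)" for l \<omega>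
  define G where "G l a \<omega> = (if tail_above_chord (m - l) l \<omega> \<and> tilted_min_at (m - l) l a \<omega> then F l \<omega> else 0)"
    for l a \<omega>
  have F_meas: "F l \<in> borel_measurable (sample k)" if "m - l \<le> k" for l k
    using measurable_compose[OF measurable_card_vertices[OF that], of "\<lambda>k. f (Suc k)" borel]
    by (simp add: F_def[abs_def])
  have H_meas: "H l \<in> borel_measurable (sample m)" if "l \<le> m" for l
    unfolding H_def[abs_def] using F_meas measurable_tail_above_chord that
    by (intro measurable_If measurable_const) (auto simp: pred_def)
  have G_meas: "G l a \<in> borel_measurable (sample m)" if "l \<le> m" "a \<le> m - l" for l a
    unfolding G_def[abs_def] using F_meas measurable_tail_above_chord[of "m - l" l m]
      measurable_tilted_min_at[of "m - l" l m a] that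
    by (intro measurable_If measurable_const pred_intros_logic) (auto simp: pred_def)
  \<comment> \<open>Reindexed samples need not be extensional; the congruences allow restricting
    them to \<open>{..<m}\<close>, back into the sample space.\<close>
  have F_cong: "F l \<omega> = F l \<omega>'" if "\<And>i. i < m - l \<Longrightarrow> \<omega> i = \<omega>' i" for l \<omega> \<omega>'
    unfolding F_def using vertices_cong[OF that] by simp
  have H_cong: "H l \<omega> = H l \<omega>'" if "\<And>i. i < m \<Longrightarrow> \<omega> i = \<omega>' i" "l \<le> m" for l \<omega> \<omega>'
    unfolding H_def using F_cong[of l \<omega> \<omega>'] tail_above_chord_cong[of "m - l" l \<omega> \<omega>'] that by simp
  have G_cong: "G l a \<omega> = G l a \<omega>'" if "\<And>i. i < m \<Longrightarrow> \<omega> i = \<omega>' i" "l \<le> m" "a \<le> m - l" for l a \<omega> \<omega>'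
    unfolding G_def using F_cong[of l \<omega> \<omega>'] tail_above_chord_cong[of "m - l" l \<omega> \<omega>']
      tilted_min_at_cong[of "m - l" l \<omega> \<omega>' a] that by simp
  have G_int: "(\<integral>\<^sup>+\<omega>. G l a (\<lambda>i. \<omega> (block_to_end m a l i)) \<partial>sample m) = (\<integral>\<^sup>+\<omega>. G l a \<omega> \<partial>sample m)"
    if "l \<le> m" "a \<le> m - l" for l a
  proof -
    have "(\<integral>\<^sup>+\<omega>. G l a (\<lambda>i. \<omega> (block_to_end m a l i)) \<partial>sample m)
      = (\<integral>\<^sup>+\<omega>. G l a (\<lambda>i\<in>{..<m}. \<omega> (block_to_end m a l i)) \<partial>sample m)"
      using that by (intro nn_integral_cong G_cong) auto
    also have "\<dots> = (\<integral>\<^sup>+\<omega>. G l a \<omega> \<partial>sample m)"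
      using that by (intro nn_integral_sample_reindex inj_on_block_to_end block_to_end_less G_meas) auto
    finally show ?thesis .
  qed
  have Gm': "(\<lambda>\<omega>. G l a (\<lambda>i. \<omega> (block_to_end m a l i))) \<in> borel_measurable (sample m)"
    if "l \<le> m" "a \<le> m - l" for l a
  proof -
    have "(\<lambda>\<omega>. \<lambda>i\<in>{..<m}. \<omega> (block_to_end m a l i)) \<in> measurable (sample m) (sample m)"
      using that by (intro measurable_restrict measurable_component_singleton) (auto simp: block_to_end_less)
    from measurable_compose[OF this G_meas[OF that]]
    have "(\<lambda>\<omega>. G l a (\<lambda>i\<in>{..<m}. \<omega> (block_to_end m a l i))) \<in> borel_measurable (sample m)" .
    also have "(\<lambda>\<omega>. G l a (\<lambda>i\<in>{..<m}. \<omega> (block_to_end m a l i))) = (\<lambda>\<omega>. G l a (\<lambda>i. \<omega> (block_to_end m a l i)))"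
      using that by (intro ext G_cong) auto
    finally show ?thesis .
  qed
  have Hm': "(\<lambda>\<omega>. H l (\<lambda>i. \<omega> (rotate_tail (m - l) l r i))) \<in> borel_measurable (sample m)"
    and H_int: "(\<integral>\<^sup>+\<omega>. H l (\<lambda>i. \<omega> (rotate_tail (m - l) l r i)) \<partial>sample m) = (\<integral>\<^sup>+\<omega>. H l \<omega> \<partial>sample m)"
    if "0 < l" "l \<le> m" for l r
  proof -
    have less: "rotate_tail (m - l) l r i < m" if "i < m" for i
      using rotate_tail_less[of l i "m - l" r] \<open>0 < l\<close> \<open>l \<le> m\<close> that by simp
    have eq: "(\<lambda>\<omega>. H l (\<lambda>i\<in>{..<m}. \<omega> (rotate_tail (m - l) l r i))) = (\<lambda>\<omega>. H l (\<lambda>i. \<omega> (rotate_tail (m - l) l r i)))"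
      using that by (intro ext H_cong) auto
    have "(\<lambda>\<omega>. \<lambda>i\<in>{..<m}. \<omega> (rotate_tail (m - l) l r i)) \<in> measurable (sample m) (sample m)"
      using less by (intro measurable_restrict measurable_component_singleton) auto
    from measurable_compose[OF this H_meas[OF that(2)]]
    show "(\<lambda>\<omega>. H l (\<lambda>i. \<omega> (rotate_tail (m - l) l r i))) \<in> borel_measurable (sample m)"
      unfolding eq .
    have "(\<integral>\<^sup>+\<omega>. H l (\<lambda>i\<in>{..<m}. \<omega> (rotate_tail (m - l) l r i)) \<partial>sample m) = (\<integral>\<^sup>+\<omega>. H l \<omega> \<partial>sample m)"
      using that less inj_on_rotate_tail[of "m - l" l r]
      by (intro nn_integral_sample_reindex H_meas) auto
    then show "(\<integral>\<^sup>+\<omega>. H l (\<lambda>i. \<omega> (rotate_tail (m - l) l r i)) \<partial>sample m) = (\<integral>\<^sup>+\<omega>. H l \<omega> \<partial>sample m)"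
      using fun_cong[OF eq] by simp
  qed
  have H_bound: "of_nat l * (\<integral>\<^sup>+\<omega>. H l \<omega> \<partial>sample m) \<le> (\<integral>\<^sup>+\<omega>. F l \<omega> \<partial>sample (m - l))"
    if l: "0 < l" "l \<le> m" for l
  proof -
    have "of_nat l * (\<integral>\<^sup>+\<omega>. H l \<omega> \<partial>sample m)
      = (\<Sum>r<l. \<integral>\<^sup>+\<omega>. H l (\<lambda>i. \<omega> (rotate_tail (m - l) l r i)) \<partial>sample m)"
      by (simp add: H_int[OF l])
    also have "\<dots> = (\<integral>\<^sup>+\<omega>. (\<Sum>r<l. H l (\<lambda>i. \<omega> (rotate_tail (m - l) l r i))) \<partial>sample m)"
      using Hm'[OF l] by (subst nn_integral_sum) auto
    also have "\<dots> \<le> (\<integral>\<^sup>+\<omega>. F l \<omega> \<partial>sample m)"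
    proof (rule nn_integral_mono_AE)
      have "AE \<omega> in sample m. \<forall>r\<in>{..<l}. \<forall>r'\<in>{..<l}.
        tail_above_chord (m - l) l (\<lambda>i. \<omega> (rotate_tail (m - l) l r i)) \<longrightarrow>
        tail_above_chord (m - l) l (\<lambda>i. \<omega> (rotate_tail (m - l) l r' i)) \<longrightarrow> r = r'"
        using l by (intro AE_tail_above_chord_rotations) auto
      then show "AE \<omega> in sample m. (\<Sum>r<l. H l (\<lambda>i. \<omega> (rotate_tail (m - l) l r i))) \<le> F l \<omega>"
      proof eventually_elim
        case (elim \<omega>)
        have "F l (\<lambda>i. \<omega> (rotate_tail (m - l) l r i)) = F l \<omega>" for r
          by (intro F_cong) (simp add: rotate_tail_def)
        then have "(\<Sum>r<l. H l (\<lambda>i. \<omega> (rotate_tail (m - l) l r i)))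
          = (\<Sum>r<l. if tail_above_chord (m - l) l (\<lambda>i. \<omega> (rotate_tail (m - l) l r i)) then F l \<omega> else 0)"
          unfolding H_def by presburger
        also have "\<dots> \<le> F l \<omega>"
          using elim by (intro sum_at_most_one_le) auto
        finally show ?case .
      qed
    qed
    also have "\<dots> = (\<integral>\<^sup>+\<omega>. F l (\<lambda>i\<in>{..<m - l}. \<omega> i) \<partial>sample m)"
      by (intro nn_integral_cong F_cong) auto
    also have "\<dots> = (\<integral>\<^sup>+\<omega>. F l \<omega> \<partial>sample (m - l))"
      by (rule nn_integral_sample_reindex[where t = "\<lambda>i. i"]) (auto intro: F_meas)
    finally show ?thesis .
  qed
  have "of_nat m * (\<integral>\<^sup>+\<omega>. f (card (vertices m \<omega>)) \<partial>sample m)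
    = (\<integral>\<^sup>+\<omega>. of_nat m * f (card (vertices m \<omega>)) \<partial>sample m)"
    using measurable_compose[OF measurable_card_vertices[of m m], of f borel]
    by (intro nn_integral_cmult[symmetric]) auto
  also have "\<dots> \<le> (\<integral>\<^sup>+\<omega>. (\<Sum>l\<in>{1..m}. \<Sum>a\<in>{..m - l}.
      of_nat l * G l a (\<lambda>i. \<omega> (block_to_end m a l i))) \<partial>sample m)"
    using face_count_inequality[of m f] unfolding G_def F_def Let_def by (intro nn_integral_mono)
  also have "\<dots> = (\<Sum>l\<in>{1..m}. \<integral>\<^sup>+\<omega>. (\<Sum>a\<in>{..m - l}.
      of_nat l * G l a (\<lambda>i. \<omega> (block_to_end m a l i))) \<partial>sample m)"
    by (rule nn_integral_sum) (auto intro!: borel_measurable_sum borel_measurable_times_ennreal Gm')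
  also have "\<dots> = (\<Sum>l\<in>{1..m}. \<Sum>a\<in>{..m - l}.
      \<integral>\<^sup>+\<omega>. of_nat l * G l a (\<lambda>i. \<omega> (block_to_end m a l i)) \<partial>sample m)"
    by (intro sum.cong refl nn_integral_sum) (auto intro!: borel_measurable_times_ennreal Gm')
  also have "\<dots> = (\<Sum>l\<in>{1..m}. \<Sum>a\<in>{..m - l}.
      of_nat l * (\<integral>\<^sup>+\<omega>. G l a (\<lambda>i. \<omega> (block_to_end m a l i)) \<partial>sample m))"
    by (intro sum.cong refl nn_integral_cmult) (auto intro!: Gm')
  also have "\<dots> = (\<Sum>l\<in>{1..m}. of_nat l * (\<Sum>a\<in>{..m - l}. \<integral>\<^sup>+\<omega>. G l a \<omega> \<partial>sample m))"
    by (simp add: G_int sum_distrib_left)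
  also have "\<dots> = (\<Sum>l\<in>{1..m}. of_nat l * (\<integral>\<^sup>+\<omega>. (\<Sum>a\<in>{..m - l}. G l a \<omega>) \<partial>sample m))"
    by (intro sum.cong refl arg_cong2[where f = "(*)"] nn_integral_sum[symmetric]) (auto intro!: G_meas)
  also have "\<dots> \<le> (\<Sum>l\<in>{1..m}. of_nat l * (\<integral>\<^sup>+\<omega>. H l \<omega> \<partial>sample m))"
  proof (intro sum_mono mult_left_mono nn_integral_mono)
    fix l \<omega>
    have "(\<Sum>a\<in>{..m - l}. if tilted_min_at (m - l) l a \<omega> then F l \<omega> else 0) \<le> F l \<omega>"
      by (intro sum_at_most_one_le) (auto intro: tilted_min_at_unique)
    then show "(\<Sum>a\<in>{..m - l}. G l a \<omega>) \<le> H l \<omega>"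
      by (simp add: G_def H_def)
  qed auto
  also have "\<dots> \<le> (\<Sum>l\<in>{1..m}. \<integral>\<^sup>+\<omega>. F l \<omega> \<partial>sample (m - l))"
    using H_bound by (intro sum_mono) auto
  finally show ?thesis by (simp add: F_def)
qed

end

section \<open>Moments of the vertex count for i.i.d. increments\<close>

lemma vertices_0 [simp]: "vertices 0 y = {}"
  by (simp add: vertices_def)

lemma sum_diff_reindex: "(\<Sum>l\<in>{1..m}. g (m - l)) = (\<Sum>j<m. g j)" for g :: "nat \<Rightarrow> 'a::comm_monoid_add"
  by (simp add: sum.atLeast1_atMost_eq sum.nat_diff_reindex)

context atomless_real_distribution
begin

text \<open>With \<open>f k = k\<close> the recursion bounds \<open>m\<close> times the mean at
  \<open>m\<close> by the sum over \<open>j < m\<close> of one plus the mean at \<open>j\<close>.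
  The harmonic numbers satisfy this with equality.\<close>

lemma nn_integral_vertices_le_harm:
  "(\<integral>\<^sup>+\<omega>. of_nat (card (vertices m \<omega>)) \<partial>sample m) \<le> ennreal (harm m)"
proof (induction m rule: less_induct)
  case (less m)
  show ?case
  proof (cases "m = 0")
    case False
    let ?E = "\<lambda>m. \<integral>\<^sup>+\<omega>. of_nat (card (vertices m \<omega>)) \<partial>sample m"
    have step: "(\<integral>\<^sup>+\<omega>. of_nat (Suc (card (vertices k \<omega>))) \<partial>sample k) = 1 + ?E k" for k
    proof -
      interpret S: prob_space "sample k" by (intro prob_space_PiM prob_space_axioms)
      have "(\<lambda>\<omega>. of_nat (card (vertices k \<omega>))) \<in> borel_measurable (sample k)"
        using measurable_compose[OF measurable_card_vertices[of k k], of of_nat borel] by simp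
      then show ?thesis
        by (subst of_nat_Suc, subst nn_integral_add) (simp_all add: S.emeasure_space_1)
    qed
    have "of_nat m * ?E m \<le> (\<Sum>l\<in>{1..m}. 1 + ?E (m - l))"
      using vertices_recursion[of m of_nat] by (simp only: step)
    also have "\<dots> \<le> (\<Sum>l\<in>{1..m}. ennreal (1 + harm (m - l)))"
      using less.IH[of "m - _"] False
      by (intro sum_mono) (auto simp: ennreal_plus harm_nonneg simp flip: ennreal_1 intro!: add_left_mono)
    also have "\<dots> = ennreal (\<Sum>j<m. 1 + harm j)"
      by (subst sum_diff_reindex[of "\<lambda>j. ennreal (1 + harm j)"])
         (rule sum_ennreal, simp add: harm_nonneg)
    also have "(\<Sum>j<m. 1 + harm j) = real m * harm m"
      by (induction m) (auto simp: harm_Suc field_simps)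
    also have "ennreal (real m * harm m) = of_nat m * ennreal (harm m)"
      by (simp add: ennreal_mult harm_nonneg ennreal_of_nat_eq_real_of_nat)
    finally show ?thesis
      using False by (subst (asm) ennreal_mult_le_mult_iff) auto
  qed simp
qed

text \<open>With \<open>f k = 2 ^ k\<close> the removed face contributes a factor 2;
  \<open>m + 1\<close> solves the resulting recursion with equality, as
  \<open>2 (1 + ... + m) = m (m + 1)\<close>.\<close>

lemma nn_integral_two_power_vertices_le:
  "(\<integral>\<^sup>+\<omega>. 2 ^ card (vertices m \<omega>) \<partial>sample m) \<le> of_nat (Suc m)"
proof (induction m rule: less_induct)
  case (less m)
  show ?case
  proof (cases "m = 0")
    case True
    interpret S: prob_space "sample 0" by (intro prob_space_PiM prob_space_axioms)
    show ?thesis using S.emeasure_space_1 True by simp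
  next
    case False
    let ?E = "\<lambda>m. \<integral>\<^sup>+\<omega>. 2 ^ card (vertices m \<omega>) \<partial>sample m"
    have step: "(\<integral>\<^sup>+\<omega>. 2 ^ Suc (card (vertices k \<omega>)) \<partial>sample k) = 2 * ?E k" for k
      using measurable_compose[OF measurable_card_vertices[of k k], of "\<lambda>n. 2 ^ n :: ennreal" borel]
      by (simp add: nn_integral_cmult)
    have "of_nat m * ?E m \<le> (\<Sum>l\<in>{1..m}. 2 * ?E (m - l))"
      using vertices_recursion[of m "\<lambda>k. 2 ^ k"] by (simp only: step)
    also have "\<dots> \<le> (\<Sum>l\<in>{1..m}. 2 * of_nat (Suc (m - l)))"
      using less.IH[of "m - _"] False by (intro sum_mono mult_left_mono) auto
    also have "\<dots> = of_nat (\<Sum>j<m. 2 * Suc j)"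
      by (subst sum_diff_reindex[of "\<lambda>j. 2 * of_nat (Suc j)"]) (simp only: of_nat_sum of_nat_mult of_nat_numeral)
    also have "(\<Sum>j<m. 2 * Suc j) = m * Suc m"
      by (induction m) auto
    finally have "of_nat m * ?E m \<le> of_nat m * of_nat (Suc m)" by (simp only: of_nat_mult)
    then show ?thesis
      using False by (subst (asm) ennreal_mult_le_mult_iff) auto
  qed
qed

end

section \<open>Tools for the passage to blocks\<close>

lemma atomless_normal:
  "0 < \<sigma> \<Longrightarrow> atomless_real_distribution (density lborel (normal_density \<mu> \<sigma>))"
proof -
  assume "0 < \<sigma>"
  then interpret prob_space "density lborel (normal_density \<mu> \<sigma>)"
    by (rule prob_space_normal_density)
  show ?thesis
  proof
    fix x :: real
    have "(\<integral>\<^sup>+y. ennreal (normal_density \<mu> \<sigma> y) * indicator {x} y \<partial>lborel) = 0"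
      by (subst nn_integral_0_iff_AE) (use AE_lborel_singleton[of x] in \<open>auto simp: indicator_def\<close>)
    then show "emeasure (density lborel (normal_density \<mu> \<sigma>)) {x} = 0"
      by (simp add: emeasure_density)
  qed simp
qed

text \<open>The slope inequalities at a vertex hold for all chords of the walk, in particular for
  those within the block; the shift of the origin cancels in differences.\<close>

lemma vertices_shift:
  assumes "i \<in> vertices n y" "a \<le> i" "i < a + l" "a + l \<le> n"
  shows "i - a \<in> vertices l (\<lambda>j. y (a + j))"
proof -
  obtain d where d: "i = a + d" using assms(2) le_Suc_ex by blast
  have "((\<Sum>j<Suc d. y (a + j)) - (\<Sum>j<p. y (a + j))) * (real q - real (Suc d))
      < ((\<Sum>j<q. y (a + j)) - (\<Sum>j<Suc d. y (a + j))) * (real (Suc d) - real p)"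
    if "p \<le> d" "Suc d < q" "q \<le> l" for p q
  proof -
    have "(sum y {..<a + Suc d} - sum y {..<a + p}) * (real (a + q) - real (a + Suc d))
      < (sum y {..<a + q} - sum y {..<a + Suc d}) * (real (a + Suc d) - real (a + p))"
      using assms(1,4) that unfolding d vertices_def
      by (auto dest!: bspec[of _ _ "a + p"] bspec[of _ _ "a + q"] simp del: sum.lessThan_Suc of_nat_Suc of_nat_add)
    then show ?thesis unfolding sum_lessThan_add of_nat_add by (simp del: sum.lessThan_Suc of_nat_Suc)
  qed
  then show ?thesis using assms d by (auto simp: vertices_def simp del: sum.lessThan_Suc of_nat_Suc)
qed

text \<open>Independence means that the joint law is the product of the marginals, and the joint map
  of the coordinates is the identity of the product space.\<close>

lemma indep_vars_PiM_coordinates: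
  assumes "\<And>i. i \<in> I \<Longrightarrow> prob_space (M i)" "finite I" "I \<noteq> {}"
  shows "prob_space.indep_vars (PiM I M) M (\<lambda>i \<omega>. \<omega> i) I"
proof -
  interpret prob_space "PiM I M" by (intro prob_space_PiM assms)
  have "distr (PiM I M) (PiM I M) (\<lambda>x. \<lambda>i\<in>I. x i) = distr (PiM I M) (PiM I M) (\<lambda>x. x)"
    by (intro distr_cong refl) (auto simp: space_PiM PiE_def extensional_restrict)
  also have "\<dots> = PiM I (\<lambda>i. distr (PiM I M) (M i) (\<lambda>\<omega>. \<omega> i))"
    using assms by (simp add: distr_PiM_component cong: PiM_cong)
  finally show ?thesis
    using assms by (subst indep_vars_iff_distr_eq_PiM') auto
qed

text \<open>The difference \<open>harm m - ln m\<close> decreases in \<open>m\<close> and equals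
  \<open>1\<close> at \<open>m = 1\<close>.\<close>

lemma harm_le_ln: "0 < m \<Longrightarrow> harm m \<le> 1 + ln (real m)"
  using decseqD[OF decseq_harm_diff_ln, of 0 "m - 1"] by (simp add: harm_def)

text \<open>Jensen's inequality for \<open>ln\<close>, obtained from its tangent at the average size
  \<open>n / k\<close>.\<close>

lemma sum_ln_le:
  fixes m :: "'a \<Rightarrow> nat"
  assumes "finite V" "V \<noteq> {}" "\<And>v. v \<in> V \<Longrightarrow> 0 < m v"
  shows "(\<Sum>v\<in>V. 1 + ln (real (m v)))
    \<le> real (card V) * ln (exp 1 * real (\<Sum>v\<in>V. m v) / real (card V))"
proof -
  define k where "k = real (card V)"
  define n where "n = real (\<Sum>v\<in>V. m v)"
  have k: "0 < k" using assms by (simp add: k_def card_gt_0_iff)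
  have n: "0 < n" using assms unfolding n_def of_nat_sum by (intro sum_pos) auto
  have "1 + ln (real (m v)) \<le> real (m v) * k / n + ln (n / k)" if "v \<in> V" for v
  proof -
    have "ln (real (m v) * k / n) \<le> real (m v) * k / n - 1"
      using assms(3)[OF that] k n by (intro ln_le_minus_one) auto
    then show ?thesis using assms(3)[OF that] k n by (simp add: ln_mult ln_div)
  qed
  then have "(\<Sum>v\<in>V. 1 + ln (real (m v))) \<le> (\<Sum>v\<in>V. real (m v) * k / n + ln (n / k))"
    by (rule sum_mono)
  also have "\<dots> = (\<Sum>v\<in>V. real (m v)) * k / n + k * ln (n / k)"
    by (simp add: sum.distrib sum_distrib_right sum_divide_distrib k_def)
  also have "\<dots> = k * (1 + ln (n / k))" using n by (simp add: n_def algebra_simps)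
  also have "1 + ln (n / k) = ln (exp 1 * n / k)" using n k by (simp add: ln_mult ln_div)
  finally show ?thesis by (simp only: k_def n_def)
qed

section \<open>Gaussian observations with a monotone mean\<close>

locale gaussian_isotonic =
  fixes n :: nat and \<sigma> :: real and \<mu> :: "nat \<Rightarrow> real"
  assumes n_pos: "0 < n" and \<sigma>_pos: "0 < \<sigma>"
    and mono: "\<And>i j. i \<le> j \<Longrightarrow> j < n \<Longrightarrow> \<mu> i \<le> \<mu> j"
begin

abbreviation noise :: "real \<Rightarrow> real measure" where
  "noise v \<equiv> density lborel (normal_density v \<sigma>)"

definition block_start :: "real \<Rightarrow> nat" where
  "block_start v = Min {i. i < n \<and> \<mu> i = v}"

definition block_size :: "real \<Rightarrow> nat" where
  "block_size v = card {i. i < n \<and> \<mu> i = v}"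

lemma block:
  assumes v: "v \<in> \<mu> ` {..<n}"
  shows "{i. i < n \<and> \<mu> i = v} = {block_start v..<block_start v + block_size v}" "0 < block_size v"
proof -
  \<comment> \<open>A monotone vector is its own fit, so the level set lemma describes the
    blocks.\<close>
  have fit: "isotonic_fit n \<mu> \<mu>" using mono by (auto simp: isotonic_fit_def)
  obtain a b where ab: "a < b" "b \<le> n" "\<And>i. i < a \<Longrightarrow> \<mu> i < v"
      "\<And>i. a \<le> i \<Longrightarrow> i < b \<Longrightarrow> \<mu> i = v" "\<And>i. b \<le> i \<Longrightarrow> i < n \<Longrightarrow> v < \<mu> i"
      "sum \<mu> {..<a} = sum \<mu> {..<a}" "sum \<mu> {..<b} = sum \<mu> {..<b}"
    using isotonic_fit_level[OF fit v] by blast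
  have eq: "{i. i < n \<and> \<mu> i = v} = {a..<b}"
  proof (intro set_eqI iffI)
    fix i assume "i \<in> {i. i < n \<and> \<mu> i = v}"
    then show "i \<in> {a..<b}" using ab(3)[of i] ab(5)[of i] by force
  next
    fix i assume "i \<in> {a..<b}"
    then show "i \<in> {i. i < n \<and> \<mu> i = v}" using ab(4)[of i] ab(2) by auto
  qed
  have "Min {a..<b} = a" using ab(1) by (intro Min_eqI) auto
  then show "{i. i < n \<and> \<mu> i = v} = {block_start v..<block_start v + block_size v}" "0 < block_size v"
    using ab(1) unfolding block_start_def block_size_def eq by auto
qed

lemma sum_block_size: "(\<Sum>v\<in>\<mu> ` {..<n}. block_size v) = n"
proof -
  have "n = card (\<Union>v\<in>\<mu> ` {..<n}. {i. i < n \<and> \<mu> i = v})"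
    by (subst card_lessThan[of n, symmetric], rule arg_cong[where f = card]) auto
  also have "\<dots> = (\<Sum>v\<in>\<mu> ` {..<n}. block_size v)"
    unfolding block_size_def by (intro card_UN_disjoint) auto
  finally show ?thesis by simp
qed

text \<open>The restriction makes the argument a point of the product space of the block, where it
  is an i.i.d. sample.\<close>

definition block_vertices :: "real \<Rightarrow> (nat \<Rightarrow> real) \<Rightarrow> nat" where
  "block_vertices v y = card (vertices (block_size v) (\<lambda>i\<in>{..<block_size v}. y (block_start v + i)))"

text \<open>Subtracting the block start maps the vertices in a block injectively to vertices of the
  block walk, which may have more of them.\<close>

lemma card_vertices_le_blocks: "card (vertices n y) \<le> (\<Sum>v\<in>\<mu> ` {..<n}. block_vertices v y)"
proof -
  have "vertices n y = (\<Union>v\<in>\<mu> ` {..<n}. {i\<in>vertices n y. \<mu> i = v})"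
    by (auto simp: vertices_def)
  then have "card (vertices n y) \<le> (\<Sum>v\<in>\<mu> ` {..<n}. card {i\<in>vertices n y. \<mu> i = v})"
    by (metis card_UN_le finite_imageI finite_lessThan)
  also have "\<dots> \<le> (\<Sum>v\<in>\<mu> ` {..<n}. block_vertices v y)"
  proof (rule sum_mono)
    fix v assume v: "v \<in> \<mu> ` {..<n}"
    let ?s = "block_start v" and ?m = "block_size v"
    have iff: "i < n \<and> \<mu> i = v \<longleftrightarrow> ?s \<le> i \<and> i < ?s + ?m" for i
      using block(1)[OF v] by (auto simp: set_eq_iff)
    have sm: "?s + ?m \<le> n" using iff[of "?s + ?m - 1"] block(2)[OF v] by auto
    have "card {i\<in>vertices n y. \<mu> i = v} \<le> card (vertices ?m (\<lambda>i. y (?s + i)))"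
    proof (rule card_inj_on_le[where f = "\<lambda>i. i - ?s"])
      have *: "?s \<le> i \<and> i < ?s + ?m" if "i \<in> {i\<in>vertices n y. \<mu> i = v}" for i
        using that iff[of i] by (auto simp: vertices_def)
      then show "inj_on (\<lambda>i. i - ?s) {i\<in>vertices n y. \<mu> i = v}"
        by (intro inj_onI) (metis le_add_diff_inverse)
      show "(\<lambda>i. i - ?s) ` {i\<in>vertices n y. \<mu> i = v} \<subseteq> vertices ?m (\<lambda>i. y (?s + i))"
        using * vertices_shift[OF _ _ _ sm] by blast
      show "finite (vertices ?m (\<lambda>i. y (?s + i)))" by (simp add: vertices_def)
    qed
    also have "vertices ?m (\<lambda>i. y (?s + i)) = vertices ?m (\<lambda>i\<in>{..<?m}. y (?s + i))"
      by (intro vertices_cong) simp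
    finally show "card {i\<in>vertices n y. \<mu> i = v} \<le> block_vertices v y"
      by (simp add: block_vertices_def)
  qed
  finally show ?thesis .
qed

lemma prob_noise: "prob_space (noise v)"
  using prob_space_normal_density[OF \<sigma>_pos] .

lemma prob_space_gauss_obs: "prob_space (gauss_obs n \<mu> \<sigma>)"
  unfolding gauss_obs_def by (intro prob_space_PiM prob_noise)

lemma block_index:
  assumes "v \<in> \<mu> ` {..<n}" "i < block_size v"
  shows "block_start v + i < n" "\<mu> (block_start v + i) = v"
proof -
  have "block_start v + i \<in> {block_start v..<block_start v + block_size v}" using assms(2) by simp
  then have "block_start v + i \<in> {i. i < n \<and> \<mu> i = v}" using block(1)[OF assms(1)] by blast
  then show "block_start v + i < n" "\<mu> (block_start v + i) = v" by auto
qed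

lemma PiM_block:
  assumes v: "v \<in> \<mu> ` {..<n}"
  shows "PiM {..<block_size v} (\<lambda>i. noise (\<mu> (block_start v + i))) = PiM {..<block_size v} (\<lambda>_. noise v)"
  by (intro PiM_cong refl) (simp add: block_index(2)[OF v])

text \<open>Stated for any \<open>J\<close> containing the block: all indices for the expectation,
  the block alone for independence.\<close>

lemma measurable_block_vertices:
  assumes v: "v \<in> \<mu> ` {..<n}" and J: "{i. i < n \<and> \<mu> i = v} \<subseteq> J"
  shows "block_vertices v \<in> measurable (PiM J (\<lambda>i. noise (\<mu> i))) (count_space UNIV)"
proof -
  interpret atomless_real_distribution "noise v" by (rule atomless_normal[OF \<sigma>_pos])
  have "(\<lambda>y. \<lambda>i\<in>{..<block_size v}. y (block_start v + i))
    \<in> measurable (PiM J (\<lambda>i. noise (\<mu> i))) (PiM {..<block_size v} (\<lambda>i. noise (\<mu> (block_start v + i))))"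
    using J block_index[OF v] by (intro measurable_restrict measurable_component_singleton) auto
  from measurable_compose[OF this[unfolded PiM_block[OF v]] measurable_card_vertices[OF order_refl]]
  show ?thesis unfolding block_vertices_def[abs_def] .
qed

text \<open>The mean is constant on a block, so the marginal there is an i.i.d. sample and the
  moment bounds apply.\<close>

lemma nn_integral_block_vertices:
  fixes f :: "nat \<Rightarrow> ennreal"
  assumes v: "v \<in> \<mu> ` {..<n}"
  shows "(\<integral>\<^sup>+y. f (block_vertices v y) \<partial>gauss_obs n \<mu> \<sigma>)
    = (\<integral>\<^sup>+\<omega>. f (card (vertices (block_size v) \<omega>)) \<partial>PiM {..<block_size v} (\<lambda>_. noise v))"
proof -
  interpret atomless_real_distribution "noise v" by (rule atomless_normal[OF \<sigma>_pos])
  have "(\<lambda>\<omega>. f (card (vertices (block_size v) \<omega>))) \<in> borel_measurable (PiM {..<block_size v} (\<lambda>_. noise v))"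
    using measurable_compose[OF measurable_card_vertices[OF order_refl], of f borel] by simp
  then show ?thesis
    unfolding gauss_obs_def block_vertices_def PiM_block[OF v, symmetric]
    by (intro nn_integral_PiM_reindex[where t = "\<lambda>i. block_start v + i"])
       (use block_index[OF v] prob_noise in auto)
qed

text \<open>The sigma-algebra does not depend on the means, so the i.i.d. case suffices.\<close>

lemma measurable_card_vertices_gauss:
  "(\<lambda>y. card (vertices n y)) \<in> measurable (gauss_obs n \<mu> \<sigma>) (count_space UNIV)"
proof -
  interpret atomless_real_distribution "noise 0" by (rule atomless_normal[OF \<sigma>_pos])
  have "sets (gauss_obs n \<mu> \<sigma>) = sets (PiM {..<n} (\<lambda>_. noise 0))"
    unfolding gauss_obs_def by (intro sets_PiM_cong) auto
  then show ?thesis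
    using measurable_card_vertices[of n n] measurable_cong_sets by blast
qed

lemma block_bound:
  "(\<Sum>v\<in>\<mu> ` {..<n}. 1 + ln (real (block_size v)))
    \<le> real (num_pieces n \<mu>) * ln (exp 1 * real n / real (num_pieces n \<mu>))"
proof -
  have "\<mu> ` {..<n} \<noteq> {}" using n_pos by (auto simp: lessThan_empty_iff)
  from sum_ln_le[of _ block_size, OF finite_imageI[OF finite_lessThan] this block(2)] show ?thesis
    unfolding sum_block_size num_pieces_def .
qed

text \<open>Linearity over the blocks, the harmonic bound for each of them, then concavity of the
  logarithm.\<close>

lemma nn_integral_num_pieces_le:
  "(\<integral>\<^sup>+y. ennreal (real (num_pieces n (iso_proj n y))) \<partial>gauss_obs n \<mu> \<sigma>)
    \<le> ennreal (real (num_pieces n \<mu>) * ln (exp 1 * real n / real (num_pieces n \<mu>)))"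
proof -
  let ?V = "\<mu> ` {..<n}"
  have "(\<integral>\<^sup>+y. ennreal (real (num_pieces n (iso_proj n y))) \<partial>gauss_obs n \<mu> \<sigma>)
    \<le> (\<integral>\<^sup>+y. (\<Sum>v\<in>?V. of_nat (block_vertices v y)) \<partial>gauss_obs n \<mu> \<sigma>)"
    unfolding num_pieces_iso_proj ennreal_of_nat_eq_real_of_nat[symmetric] of_nat_sum[symmetric]
    by (intro nn_integral_mono of_nat_mono card_vertices_le_blocks)
  also have "\<dots> = (\<Sum>v\<in>?V. \<integral>\<^sup>+y. of_nat (block_vertices v y) \<partial>gauss_obs n \<mu> \<sigma>)"
  proof (rule nn_integral_sum)
    fix v assume "v \<in> ?V"
    from measurable_compose[OF measurable_block_vertices[OF this, of "{..<n}"], of of_nat borel]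
    show "(\<lambda>y. of_nat (block_vertices v y)) \<in> borel_measurable (gauss_obs n \<mu> \<sigma>)"
      by (auto simp: gauss_obs_def)
  qed
  also have "\<dots> \<le> (\<Sum>v\<in>?V. ennreal (1 + ln (real (block_size v))))"
  proof (rule sum_mono)
    fix v assume v: "v \<in> ?V"
    interpret atomless_real_distribution "noise v" by (rule atomless_normal[OF \<sigma>_pos])
    have "(\<integral>\<^sup>+y. of_nat (block_vertices v y) \<partial>gauss_obs n \<mu> \<sigma>) \<le> ennreal (harm (block_size v))"
      unfolding nn_integral_block_vertices[OF v] by (rule nn_integral_vertices_le_harm)
    also have "\<dots> \<le> ennreal (1 + ln (real (block_size v)))"
      using harm_le_ln[OF block(2)[OF v]] by (rule ennreal_leI)
    finally show "(\<integral>\<^sup>+y. of_nat (block_vertices v y) \<partial>gauss_obs n \<mu> \<sigma>) \<le> \<dots>" .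
  qed
  also have "\<dots> = ennreal (\<Sum>v\<in>?V. 1 + ln (real (block_size v)))"
  proof (rule sum_ennreal)
    fix v assume "v \<in> ?V"
    then have "1 \<le> real (block_size v)" using block(2)[of v] by simp
    then show "0 \<le> 1 + ln (real (block_size v))" by (simp add: add_nonneg_nonneg)
  qed
  also have "\<dots> \<le> ennreal (real (num_pieces n \<mu>) * ln (exp 1 * real n / real (num_pieces n \<mu>)))"
    using block_bound by (rule ennreal_leI)
  finally show ?thesis .
qed

text \<open>Different blocks read disjoint coordinates, so their counts are independent and the
  exponential moment of their sum factorises.\<close>

lemma nn_integral_two_power_num_pieces_le:
  "(\<integral>\<^sup>+y. 2 ^ card (vertices n y) \<partial>gauss_obs n \<mu> \<sigma>) \<le> (\<Prod>v\<in>\<mu> ` {..<n}. of_nat (Suc (block_size v)))"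
proof -
  let ?V = "\<mu> ` {..<n}"
  let ?I = "\<lambda>v. {i. i < n \<and> \<mu> i = v}"
  interpret prob_space "gauss_obs n \<mu> \<sigma>" by (rule prob_space_gauss_obs)
  define Y where "Y v y = (2 ^ block_vertices v y :: ennreal)" for v y
  have "indep_vars (\<lambda>i. noise (\<mu> i)) (\<lambda>i \<omega>. \<omega> i) {..<n}"
    unfolding gauss_obs_def using n_pos prob_noise
    by (intro indep_vars_PiM_coordinates) (auto simp: lessThan_empty_iff)
  then have "indep_vars (\<lambda>v. PiM (?I v) (\<lambda>i. noise (\<mu> i))) (\<lambda>v \<omega>. restrict (\<lambda>i. \<omega> i) (?I v)) ?V"
    by (rule indep_vars_restrict) (auto simp: disjoint_family_on_def)
  then have "indep_vars (\<lambda>_. borel) (\<lambda>v \<omega>. Y v (restrict (\<lambda>i. \<omega> i) (?I v))) ?V"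
  proof (rule indep_vars_compose2)
    fix v assume "v \<in> ?V"
    from measurable_compose[OF measurable_block_vertices[OF this order_refl], of "\<lambda>k. 2 ^ k" borel]
    show "Y v \<in> borel_measurable (PiM (?I v) (\<lambda>i. noise (\<mu> i)))"
      by (simp add: Y_def[abs_def])
  qed
  \<comment> \<open>Independence was obtained for the restricted coordinates; \<open>Y v\<close>
    reads no others.\<close>
  moreover have "Y v (restrict (\<lambda>i. \<omega> i) (?I v)) = Y v \<omega>" if "v \<in> ?V" for v \<omega>
    using block_index[OF that] by (auto simp: Y_def block_vertices_def restrict_def cong: if_cong intro!: arg_cong[where f = card] vertices_cong)
  ultimately have ind: "indep_vars (\<lambda>_. borel) Y ?V"
    by (subst (asm) indep_vars_cong[OF refl _ refl, where Y = Y]) auto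
  have "(\<integral>\<^sup>+y. 2 ^ card (vertices n y) \<partial>gauss_obs n \<mu> \<sigma>) \<le> (\<integral>\<^sup>+y. (\<Prod>v\<in>?V. Y v y) \<partial>gauss_obs n \<mu> \<sigma>)"
    unfolding Y_def power_sum[symmetric]
    by (intro nn_integral_mono power_increasing card_vertices_le_blocks) auto
  also have "\<dots> = (\<Prod>v\<in>?V. \<integral>\<^sup>+y. Y v y \<partial>gauss_obs n \<mu> \<sigma>)"
    using ind by (intro indep_vars_nn_integral) auto
  also have "\<dots> \<le> (\<Prod>v\<in>?V. of_nat (Suc (block_size v)))"
  proof (rule prod_mono_ennreal)
    fix v assume v: "v \<in> ?V"
    interpret v: atomless_real_distribution "noise v" by (rule atomless_normal[OF \<sigma>_pos])
    show "(\<integral>\<^sup>+y. Y v y \<partial>gauss_obs n \<mu> \<sigma>) \<le> of_nat (Suc (block_size v))"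
      unfolding Y_def nn_integral_block_vertices[OF v, of "\<lambda>k. 2 ^ k"]
      by (rule v.nn_integral_two_power_vertices_le)
  qed
  finally show ?thesis .
qed

text \<open>Markov's inequality for \<open>2 ^ card (vertices n y)\<close> at level
  \<open>2 powr c\<close>, once the moment bound \<open>R\<close> is seen to be at most
  \<open>\<gamma> * 2 powr c\<close>.\<close>

lemma num_pieces_tail:
  assumes "0 < \<gamma>" "\<gamma> < 1"
  shows "1 - \<gamma> \<le> measure (gauss_obs n \<mu> \<sigma>)
    {y \<in> space (gauss_obs n \<mu> \<sigma>). real (num_pieces n (iso_proj n y))
      \<le> 2 * real (num_pieces n \<mu>) * ln (exp 1 * real n / real (num_pieces n \<mu>)) + 7 * ln (1 / \<gamma>)}"
proof -
  let ?P = "gauss_obs n \<mu> \<sigma>"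
  let ?V = "\<mu> ` {..<n}"
  interpret prob_space ?P by (rule prob_space_gauss_obs)
  define M where "M = real (num_pieces n \<mu>) * ln (exp 1 * real n / real (num_pieces n \<mu>))"
  define c where "c = 2 * M + 7 * ln (1 / \<gamma>)"
  define A where "A = {y \<in> space ?P. c < real (card (vertices n y))}"
  note [measurable] = measurable_card_vertices_gauss
  have A: "A \<in> events" unfolding A_def by measurable
  define R where "R = (\<Prod>v\<in>?V. real (Suc (block_size v)))"
  have size: "1 \<le> real (block_size v)" if "v \<in> ?V" for v using block(2)[OF that] by simp
  \<comment> \<open>The lower bound makes \<open>2 * ln 2\<close> and \<open>7 * ln 2\<close> at
    least \<open>1\<close>, which is what the two constants have to achieve; the upper one absorbs
    the \<open>ln 2\<close> from \<open>block_size v + 1 <= 2 * block_size v\<close>.\<close>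
  have ln2: "1 / 2 \<le> ln (2::real)" "ln (2::real) \<le> 1"
    using ln2_ge_two_thirds ln_le_minus_one[of "2::real"] by auto
  have M0: "0 \<le> M"
    using block_bound size order_trans[OF sum_nonneg[of ?V "\<lambda>v. 1 + ln (real (block_size v))"]]
    unfolding M_def by (simp add: add_nonneg_nonneg)
  have "ln R = (\<Sum>v\<in>?V. ln (real (Suc (block_size v))))"
    unfolding R_def by (subst ln_prod) auto
  also have "\<dots> \<le> (\<Sum>v\<in>?V. 1 + ln (real (block_size v)))"
  proof (rule sum_mono)
    fix v assume v: "v \<in> ?V"
    have "ln (real (Suc (block_size v))) \<le> ln (2 * real (block_size v))"
      using size[OF v] by (intro ln_mono) auto
    also have "\<dots> = ln 2 + ln (real (block_size v))" using size[OF v] by (simp add: ln_mult)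
    finally show "ln (real (Suc (block_size v))) \<le> 1 + ln (real (block_size v))" using ln2 by simp
  qed
  also have "\<dots> \<le> M" unfolding M_def by (rule block_bound)
  finally have lnR: "ln R \<le> M" .
  have R0: "0 < R" unfolding R_def by (intro prod_pos) auto
  have "M + ln (1 / \<gamma>) \<le> c * ln 2"
  proof -
    have L: "0 \<le> ln (1 / \<gamma>)" using assms by simp
    have "M * 1 \<le> M * (2 * ln 2)" "ln (1 / \<gamma>) * 1 \<le> ln (1 / \<gamma>) * (7 * ln 2)"
      using ln2 M0 L by (intro mult_left_mono; simp)+
    then show ?thesis by (simp add: c_def algebra_simps)
  qed
  then have "ln R \<le> ln (\<gamma> * 2 powr c)"
    using lnR assms by (simp add: ln_mult ln_powr ln_div)
  then have R: "R \<le> \<gamma> * 2 powr c" using R0 assms by (subst (asm) ln_le_cancel_iff) auto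
  have "ennreal (2 powr c) * emeasure ?P A = (\<integral>\<^sup>+y. ennreal (2 powr c) * indicator A y \<partial>?P)"
    using A by (simp add: nn_integral_cmult_indicator)
  also have "\<dots> \<le> (\<integral>\<^sup>+y. 2 ^ card (vertices n y) \<partial>?P)"
  proof (rule nn_integral_mono)
    fix y
    have "ennreal (2 powr c) \<le> ennreal (2 ^ card (vertices n y))" if "y \<in> A"
      using that by (intro ennreal_leI) (auto simp: A_def simp flip: powr_realpow)
    also have "ennreal (2 ^ card (vertices n y)) = 2 ^ card (vertices n y)"
      by (simp add: ennreal_power[symmetric])
    finally show "ennreal (2 powr c) * indicator A y \<le> 2 ^ card (vertices n y)"
      by (auto simp: indicator_def)
  qed
  also have "\<dots> \<le> (\<Prod>v\<in>?V. of_nat (Suc (block_size v)))"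
    by (rule nn_integral_two_power_num_pieces_le)
  also have "\<dots> = ennreal R"
    unfolding R_def ennreal_of_nat_eq_real_of_nat by (rule prod_ennreal) simp
  also have "\<dots> \<le> ennreal (\<gamma> * 2 powr c)" using R by (rule ennreal_leI)
  finally have "2 powr c * prob A \<le> \<gamma> * 2 powr c"
    using assms by (simp add: emeasure_eq_measure flip: ennreal_mult)
  then have "prob A \<le> \<gamma>" by (simp add: mult.commute)
  moreover have "prob (space ?P - A) = 1 - prob A" using A by (rule prob_compl)
  moreover have "space ?P - A = {y \<in> space ?P. real (num_pieces n (iso_proj n y)) \<le> c}"
    by (auto simp: A_def num_pieces_iso_proj)
  ultimately show ?thesis by (simp add: c_def M_def mult.assoc)
qed

end

theorem mainTheorem2:
  fixes n :: nat and \<sigma> :: real and \<mu> :: "nat \<Rightarrow> real"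
  assumes "n \<ge> 1" and "\<sigma> > 0" and "\<mu> \<in> mono_cone n"
  shows "(\<forall>\<gamma>::real. 0 < \<gamma> \<and> \<gamma> < 1 \<longrightarrow>
            measure (gauss_obs n \<mu> \<sigma>)
              {y \<in> space (gauss_obs n \<mu> \<sigma>).
                 real (num_pieces n (iso_proj n y))
                   \<le> 2 * real (num_pieces n \<mu>) * ln (exp 1 * real n / real (num_pieces n \<mu>))
                     + 7 * ln (1 / \<gamma>)} \<ge> 1 - \<gamma>)
       \<and> (\<integral>\<^sup>+ y. ennreal (real (num_pieces n (iso_proj n y))) \<partial>(gauss_obs n \<mu> \<sigma>))
           \<le> ennreal (real (num_pieces n \<mu>) * ln (exp 1 * real n / real (num_pieces n \<mu>)))"
proof -
  interpret gaussian_isotonic n \<sigma> \<mu>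
    using assms by unfold_locales (auto simp: mono_cone_def)
  show ?thesis using num_pieces_tail nn_integral_num_pieces_le by blast
qed

end
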